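(* Let $\delta>0$ and let $\mathcal{X}$ be a $\delta$-well spaced subset of $\mathbb{R}/\mathbb{Z}$. Let $N\ge 1000$, $M\ge0$ and $h>0$ be real numbers, and let $(u_p)_{M+1\le p\le M+N}$ be complex numbers indexed by the primes in $[M+1,M+N]$. Then $$\sum_{x\in\mathcal{X}}\Bigl|\sum_{M+1\le p\le M+N}u_p e(xp)\Bigr|^{2+h}\le 14000\bigl(2^h+1/h\bigr)\Bigl(\frac{N+\delta^{-1}}{\log N}\sum_{M+1\le p\le M+N}|u_p|^2\Bigr)^{1+h/2}.$$
   Context: The variable $p$ always denotes a prime number, and sums over $p$ run over primes. We write $e(\alpha)=\exp(2i\pi\alpha)$, and $|y|_{\mathbb{Z}}=\min_{k\in\mathbb{Z}}|y-k|$ for the distance of $y$ to the nearest integer. A set $\mathcal{X}\subset\mathbb{R}/\mathbb{Z}$ is called $\delta$-well spaced when $|x-x'|_{\mathbb{Z}}\ge\delta$ for all distinct $x,x'\in\mathcal{X}$ (such a set is finite). *)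

theory Defs
  imports Complex_Main "HOL-Computational_Algebra.Primes"
begin

definition e_unit :: "real \<Rightarrow> complex" where
  "e_unit \<alpha> = exp (2 * \<i> * complex_of_real pi * complex_of_real \<alpha>)"

definition dist_Z :: "real \<Rightarrow> real" where
  "dist_Z y = (INF k::int. \<bar>y - real_of_int k\<bar>)"

(* A subset of R/Z is given by a set X of real representatives, which need not lie in [0,1).
   For \<delta> > 0 distinct elements of a well spaced X lie in distinct classes modulo 1,
   since dist_Z vanishes on the integers. *)
definition well_spaced :: "real \<Rightarrow> real set \<Rightarrow> bool" where
  "well_spaced \<delta> X \<longleftrightarrow> (\<forall>x\<in>X. \<forall>x'\<in>X. x \<noteq> x' \<longrightarrow> \<delta> \<le> dist_Z (x - x'))"

definition primes_between :: "real \<Rightarrow> real \<Rightarrow> nat set" where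
  "primes_between a b = {p. prime p \<and> a \<le> real p \<and> real p \<le> b}"

lemma dist_Z_le: "dist_Z y \<le> \<bar>y - real_of_int k\<bar>"
  unfolding dist_Z_def by (rule cINF_lower) (auto intro!: bdd_belowI2[where m = 0])

(* The sum over X in the main inequality relies on this: a sum over an infinite set is 0. *)
lemma well_spaced_finite:
  assumes "0 < \<delta>" and ws: "well_spaced \<delta> X"
  shows "finite X"
proof (rule inj_on_finite)
  let ?f = "\<lambda>x. \<lfloor>frac x / \<delta>\<rfloor>"
  show "inj_on ?f X"
  proof (rule inj_onI, rule ccontr)
    fix x x' assume *: "x \<in> X" "x' \<in> X" "?f x = ?f x'" "x \<noteq> x'"
    have "\<bar>frac x / \<delta> - frac x' / \<delta>\<bar> < 1"
      using *(3) by linarith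
    then have "\<bar>frac x - frac x'\<bar> < \<delta>"
      using \<open>0 < \<delta>\<close> by (simp add: diff_divide_distrib [symmetric] abs_divide)
    moreover have "\<delta> \<le> dist_Z (x - x')"
      using ws * unfolding well_spaced_def by blast
    moreover have "dist_Z (x - x') \<le> \<bar>frac x - frac x'\<bar>"
      using dist_Z_le[of "x - x'" "\<lfloor>x\<rfloor> - \<lfloor>x'\<rfloor>"] by (simp add: frac_def algebra_simps)
    ultimately show False by linarith
  qed
  show "?f ` X \<subseteq> {0..\<lfloor>1 / \<delta>\<rfloor>}"
  proof clarsimp
    fix x :: real
    have "0 \<le> frac x" "frac x \<le> 1"
      using frac_ge_0[of x] frac_lt_1[of x] by linarith+
    then show "0 \<le> frac x / \<delta> \<and> \<lfloor>frac x / \<delta>\<rfloor> \<le> \<lfloor>1 / \<delta>\<rfloor>"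
      using \<open>0 < \<delta>\<close> by (auto intro!: floor_mono divide_right_mono)
  qed
qed simp

end

theory Submission
  imports Defs "HOL-Analysis.Analysis" "HOL-Number_Theory.Totient"
    "HOL-Computational_Algebra.Squarefree"
begin

text \<open>
Write \<open>T x\<close> for the exponential sum at \<open>x\<close>, \<open>W\<close> for \<open>\<Sum>\<bar>u p\<bar>\<^sup>2\<close>, and put
\<open>C = (N + 1/\<delta>) / ln N * W\<close>. Two inequalities carry the proof. A single value satisfies
\<open>\<bar>T x\<bar>\<^sup>2 \<le> 4 C\<close>, by Cauchy-Schwarz and the Brun-Titchmarsh bound \<open>4 N / ln N\<close> for the number of primes
involved (\<open>brun_titchmarsh\<close>). And \<open>K \<ge> 3500\<close> well spaced values satisfy
\<open>\<Sum>\<bar>T x\<bar>\<^sup>2 \<le> 1600 C ln K\<close> (\<open>many_points_large_sieve\<close>).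

These two suffice. Arrange the numbers \<open>\<bar>T x\<bar>\<^sup>2 / C\<close> in decreasing order. The partial sums of the
resulting sequence are at most those of the sequence \<open>4, \<dots>, 4, 3500/3501, 3500/3502, \<dots>\<close> with 3500 terms
equal to 4, so by summation by parts and Young's inequality its sum of \<open>s\<close>-th powers,
\<open>s = 1 + h/2\<close>, is at most that of the comparison sequence, which is at most
\<open>14000 * 2\<^sup>h + 7000/h\<close>. Using the logarithmic growth only through partial sums, and not through
the size of level sets, is what leads to \<open>1/h\<close> rather than \<open>1/h\<^sup>2\<close>.

The bound for \<open>K\<close> points improves the large sieve inequality \<open>\<Sum>\<bar>T x\<bar>\<^sup>2 \<le> (N + 2/\<delta>) W\<close> by a factor of
order \<open>ln N / ln K\<close>. The improvement comes from the fact that \<open>T\<close> is supported on primes: for squarefree \<open>q\<close>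
coprime to all of them, the Ramanujan sum identity and Cauchy-Schwarz give
\<open>\<bar>T x\<bar>\<^sup>2 / \<phi>(q) \<le> \<Sum>\<bar>T (x + a/q)\<bar>\<^sup>2\<close>, the sum being over the reduced residues \<open>a\<close> modulo \<open>q\<close>. Summed over a set
of moduli \<open>q \<le> Q\<close> this gains the factor \<open>\<Sum>1/\<phi>(q)\<close>, provided that the points \<open>x + a/q\<close> are still well
spaced. For one \<open>x\<close> they are. Points belonging to \<open>x\<close> and \<open>x'\<close> can only collide when \<open>x - x'\<close> is very
close to a fraction, not an integer, with denominator dividing \<open>q q'\<close>; at most one fraction with denominator up to \<open>Q\<^sup>2\<close>
is that close, and if \<open>P\<close> is a prime dividing its reduced denominator, then \<open>P\<close> divides \<open>q\<close> or \<open>q'\<close>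
(\<open>separating_prime\<close>). Hence discarding the multiples of \<open>P\<close> removes all the collisions between \<open>x\<close>
and \<open>x'\<close>. If the moduli have only prime factors exceeding \<open>K\<^sup>2\<close>, all the discarded moduli together
account for at most the fraction \<open>1/K\<close> of \<open>\<Sum>1/\<phi>(q)\<close>. What remains is of order \<open>ln Q / ln K\<close> by an
elementary estimate of Mertens type (\<open>rough_totient_sum_ge\<close>).

The Brun-Titchmarsh bound is the case of the single point \<open>x = 0\<close>, where all squarefree moduli up
to \<open>Q\<close> may be used.
\<close>

section \<open>Additive characters and the distance to the nearest integer\<close>

lemma e_unit_cis: "e_unit t = cis (2 * pi * t)"
  by (simp add: e_unit_def cis_conv_exp mult_ac)

lemma e_unit_0 [simp]: "e_unit 0 = 1"
  by (simp add: e_unit_def)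

lemma norm_e_unit [simp]: "norm (e_unit t) = 1"
  by (simp add: e_unit_cis)

lemma e_unit_add: "e_unit (s + t) = e_unit s * e_unit t"
  by (simp add: e_unit_cis cis_mult algebra_simps)

lemma e_unit_of_int: "e_unit (real_of_int k) = 1"
  by (simp add: e_unit_cis)

lemma cnj_e_unit: "cnj (e_unit t) = e_unit (- t)"
  by (simp add: e_unit_cis cis_cnj)

lemma e_unit_power: "e_unit (real k * t) = e_unit t ^ k"
  by (simp add: e_unit_cis Complex.DeMoivre mult_ac)

lemma dist_Z_attained: obtains k where "dist_Z y = \<bar>y - real_of_int k\<bar>" "dist_Z y \<le> 1 / 2"
proof -
  have "\<bar>y - real_of_int (round y)\<bar> \<le> \<bar>y - real_of_int k\<bar>" for k
    using round_diff_minimal[of y k] by simp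
  then have "dist_Z y = \<bar>y - real_of_int (round y)\<bar>"
    by (intro antisym dist_Z_le) (auto simp: dist_Z_def intro!: cINF_greatest)
  moreover have "\<bar>y - real_of_int (round y)\<bar> \<le> 1 / 2"
    using of_int_round_abs_le[of y] by (simp add: abs_minus_commute)
  ultimately show ?thesis using that by metis
qed

lemma dist_Z_minus: "dist_Z (- y) = dist_Z y"
proof -
  have le: "dist_Z (- y) \<le> dist_Z y" for y
  proof (rule dist_Z_attained[of y])
    fix k assume "dist_Z y = \<bar>y - real_of_int k\<bar>"
    then show ?thesis using dist_Z_le[of "- y" "- k"] by (simp add: abs_minus_commute)
  qed
  show ?thesis using le[of y] le[of "- y"] by simp
qed

text \<open>Jordan's inequality: by concavity the sine lies above its chord over \<open>[0, \<pi>/2]\<close>.\<close>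

lemma sin_ge_chord:
  assumes "0 \<le> x" "x \<le> pi / 2"
  shows "2 * x / pi \<le> sin x"
proof -
  have "convex_on {0..pi/2} (\<lambda>x. - sin x)"
    by (rule f''_ge0_imp_convex[where f' = "\<lambda>x. - cos x" and f'' = "\<lambda>x. sin x"])
       (auto intro!: derivative_eq_intros sin_ge_zero)
  from convex_onD[OF this, of "2 * x / pi" 0 "pi / 2"] assms
  show ?thesis by (simp add: field_simps)
qed

lemma norm_one_minus_e_unit: "4 * dist_Z t \<le> norm (1 - e_unit t)"
proof (rule dist_Z_attained[of t])
  fix k assume k: "dist_Z t = \<bar>t - real_of_int k\<bar>" "dist_Z t \<le> 1 / 2"
  define s where "s = t - real_of_int k"
  have "e_unit t = e_unit s"
    using e_unit_add[of s "real_of_int k"] by (simp add: s_def e_unit_of_int)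
  have "(norm (1 - e_unit s))\<^sup>2 = (1 - cos (2 * (pi * s)))\<^sup>2 + (sin (2 * (pi * s)))\<^sup>2"
    by (simp add: e_unit_cis cmod_power2 mult.assoc)
  also have "\<dots> = (2 * \<bar>sin (pi * s)\<bar>)\<^sup>2"
    by (simp add: power_mult_distrib cos_double_sin sin_double)
       (simp add: power2_eq_square algebra_simps cos_squared_eq flip: power2_eq_square)
  finally have eq: "norm (1 - e_unit s) = 2 * \<bar>sin (pi * s)\<bar>"
    by (subst (asm) power2_eq_iff_nonneg) auto
  have "2 * (pi * \<bar>s\<bar>) / pi \<le> sin (pi * \<bar>s\<bar>)"
    by (rule sin_ge_chord) (use k in \<open>auto simp: s_def\<close>)
  also have "\<dots> \<le> \<bar>sin (pi * s)\<bar>"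
    by (cases "s \<ge> 0") auto
  finally show ?thesis using eq k \<open>e_unit t = e_unit s\<close> by (simp add: s_def)
qed

lemma norm_geometric_e_unit:
  assumes "0 < dist_Z t"
  shows "norm (\<Sum>k<n. e_unit ((c + real k) * t)) \<le> 1 / (2 * dist_Z t)"
proof -
  have n1: "norm (1 - e_unit t) > 0" and ne: "e_unit t \<noteq> 1"
    using norm_one_minus_e_unit[of t] assms by (auto simp: less_le_trans)
  have "(\<Sum>k<n. e_unit ((c + real k) * t)) = e_unit (c * t) * (\<Sum>k<n. e_unit t ^ k)"
    by (simp add: sum_distrib_left distrib_right e_unit_add e_unit_power)
  also have "norm \<dots> = norm (1 - e_unit t ^ n) / norm (1 - e_unit t)"
    using ne by (simp add: norm_mult sum_gp_strict norm_divide)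
  also have "\<dots> \<le> 2 / (4 * dist_Z t)"
  proof (rule frac_le)
    show "norm (1 - e_unit t ^ n) \<le> 2"
      using norm_triangle_ineq4[of 1 "e_unit t ^ n"] by (simp add: norm_power)
  qed (use assms norm_one_minus_e_unit[of t] in auto)
  finally show ?thesis by simp
qed

section \<open>The large sieve inequality\<close>

lemma sum_inverse_squares_le: "(\<Sum>k=1..n. 1 / (real k)\<^sup>2) \<le> 2"
proof -
  have "(\<Sum>k=1..n. 1 / (real k)\<^sup>2) \<le> 2 - 1 / real n"
  proof (induction n)
    case (Suc n)
    have "1 / (real (Suc n))\<^sup>2 + 1 / real (Suc n) \<le> 1 / real n" if "n > 0"
      using that by (simp add: divide_simps power2_eq_square) (simp add: algebra_simps)
    with Suc show ?case by (cases "n = 0") auto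
  qed simp
  then show ?thesis by (smt (verit) of_nat_0_le_iff divide_nonneg_nonneg)
qed

text \<open>The intervals \<open>[k \<delta>, (k + 1) \<delta>)\<close> with \<open>k \<ge> 1\<close> cover the points and contain at most one of them each, so the
sum is at most \<open>\<Sum>1/(k \<delta>)\<^sup>2\<close>.\<close>

lemma spaced_reals_sum_inverse_squares:
  fixes t :: "'a \<Rightarrow> real"
  assumes fin: "finite J" and "0 < \<delta>"
    and ge: "\<And>j. j \<in> J \<Longrightarrow> \<delta> \<le> t j"
    and sp: "\<And>j k. j \<in> J \<Longrightarrow> k \<in> J \<Longrightarrow> j \<noteq> k \<Longrightarrow> \<delta> \<le> \<bar>t j - t k\<bar>"
  shows "(\<Sum>j\<in>J. 1 / (t j)\<^sup>2) \<le> 2 / \<delta>\<^sup>2"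
proof -
  define f where "f j = nat \<lfloor>t j / \<delta>\<rfloor>" for j
  have f1: "1 \<le> f j" "real (f j) * \<delta> \<le> t j" "t j < (real (f j) + 1) * \<delta>" if "j \<in> J" for j
  proof -
    have 1: "1 \<le> t j / \<delta>" using ge[OF that] \<open>0 < \<delta>\<close> by simp
    then have "1 \<le> \<lfloor>t j / \<delta>\<rfloor>" by simp
    then show "1 \<le> f j" by (simp add: f_def nat_le_iff le_nat_iff del: One_nat_def)
    have r: "real (f j) = of_int \<lfloor>t j / \<delta>\<rfloor>" using \<open>1 \<le> \<lfloor>t j / \<delta>\<rfloor>\<close> by (simp add: f_def)
    have "real (f j) \<le> t j / \<delta>" "t j / \<delta> < real (f j) + 1" unfolding r by linarith+
    then show "real (f j) * \<delta> \<le> t j" "t j < (real (f j) + 1) * \<delta>"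
      using \<open>0 < \<delta>\<close> by (simp_all add: field_simps)
  qed
  have inj: "inj_on f J"
  proof (rule inj_onI, rule ccontr)
    fix j k assume jk: "j \<in> J" "k \<in> J" "f j = f k" "j \<noteq> k"
    then have "\<bar>t j - t k\<bar> < \<delta>"
      using f1[of j] f1[of k] by (simp add: distrib_right abs_less_iff)
    with sp[of j k] jk show False by simp
  qed
  have "(\<Sum>j\<in>J. 1 / (t j)\<^sup>2) \<le> (\<Sum>j\<in>J. 1 / (real (f j) * \<delta>)\<^sup>2)"
  proof (rule sum_mono)
    fix j assume "j \<in> J"
    then have "0 < real (f j) * \<delta>" "real (f j) * \<delta> \<le> t j" using f1[of j] \<open>0 < \<delta>\<close> by auto
    then show "1 / (t j)\<^sup>2 \<le> 1 / (real (f j) * \<delta>)\<^sup>2"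
      by (intro frac_le power_mono zero_less_power) (assumption | linarith)+
  qed
  also have "\<dots> = (\<Sum>k\<in>f ` J. 1 / (real k * \<delta>)\<^sup>2)"
    using inj by (simp add: sum.reindex)
  also have "\<dots> \<le> (\<Sum>k=1..Max (insert 0 (f ` J)). 1 / (real k * \<delta>)\<^sup>2)"
    by (rule sum_mono2) (use fin f1 in auto)
  also have "\<dots> = (\<Sum>k=1..Max (insert 0 (f ` J)). 1 / (real k)\<^sup>2) / \<delta>\<^sup>2"
    by (simp add: sum_divide_distrib power_mult_distrib)
  also have "\<dots> \<le> 2 / \<delta>\<^sup>2"
    by (intro divide_right_mono sum_inverse_squares_le) auto
  finally show ?thesis .
qed

text \<open>Representatives of the differences \<open>y i - y j\<close> modulo 1 of least absolute value are points of the
real line at mutual distance at least \<open>\<delta>\<close> and at distance at least \<open>\<delta>\<close> from 0; positive and negative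
ones contribute \<open>2/\<delta>\<^sup>2\<close> each.\<close>

lemma spaced_sum_inverse_squares:
  fixes y :: "'a \<Rightarrow> real"
  assumes fin: "finite I" and \<delta>: "0 < \<delta>"
    and sp: "\<And>i j. i \<in> I \<Longrightarrow> j \<in> I \<Longrightarrow> i \<noteq> j \<Longrightarrow> \<delta> \<le> dist_Z (y i - y j)"
    and i: "i \<in> I"
  shows "(\<Sum>j\<in>I - {i}. 1 / (dist_Z (y i - y j))\<^sup>2) \<le> 4 / \<delta>\<^sup>2"
proof -
  have "\<forall>j. \<exists>k. dist_Z (y i - y j) = \<bar>y i - y j - real_of_int k\<bar>"
    by (metis dist_Z_attained)
  then obtain k where k: "\<And>j. dist_Z (y i - y j) = \<bar>y i - y j - real_of_int (k j)\<bar>"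
    by metis
  define t where "t j = y i - y j - real_of_int (k j)" for j
  define J where "J = I - {i}"
  have J: "finite J" "J \<subseteq> I" using fin by (auto simp: J_def)
  have big: "\<delta> \<le> \<bar>t j\<bar>" if "j \<in> J" for j
    using sp[of i j] that i by (auto simp: J_def k t_def)
  have spt: "\<delta> \<le> \<bar>t j - t l\<bar>" if "j \<in> J" "l \<in> J" "j \<noteq> l" for j l
  proof -
    have "\<delta> \<le> dist_Z (y l - y j)" using sp that J by auto
    also have "\<dots> \<le> \<bar>y l - y j - real_of_int (k j - k l)\<bar>" by (rule dist_Z_le)
    also have "\<dots> = \<bar>t j - t l\<bar>" by (simp add: t_def algebra_simps)
    finally show ?thesis .
  qed
  have "(\<Sum>j\<in>J. 1 / (t j)\<^sup>2) = (\<Sum>j\<in>{j\<in>J. 0 \<le> t j}. 1 / (t j)\<^sup>2) + (\<Sum>j\<in>{j\<in>J. t j < 0}. 1 / (t j)\<^sup>2)"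
    using J by (subst sum.union_disjoint[symmetric]) (auto intro!: sum.cong)
  also have "(\<Sum>j\<in>{j\<in>J. 0 \<le> t j}. 1 / (t j)\<^sup>2) \<le> 2 / \<delta>\<^sup>2"
    by (rule spaced_reals_sum_inverse_squares) (use J \<delta> big spt in force)+
  also have "(\<Sum>j\<in>{j\<in>J. t j < 0}. 1 / (t j)\<^sup>2) = (\<Sum>j\<in>{j\<in>J. t j < 0}. 1 / (- t j)\<^sup>2)"
    by simp
  also have "\<dots> \<le> 2 / \<delta>\<^sup>2"
  proof (rule spaced_reals_sum_inverse_squares)
    fix j l assume "j \<in> {j\<in>J. t j < 0}" "l \<in> {j\<in>J. t j < 0}" "j \<noteq> l"
    then show "\<delta> \<le> \<bar>- t j - - t l\<bar>" using spt[of l j] by (simp add: abs_minus_commute)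
  qed (use J \<delta> big in force)+
  finally show ?thesis by (simp add: J_def k t_def)
qed

lemma of_real_sum_norm_squares_expand:
  fixes v :: "'a \<Rightarrow> complex"
  assumes "finite I"
  shows "complex_of_real ((norm (\<Sum>i\<in>I. v i * e_unit (t * y i)))\<^sup>2)
    = (\<Sum>i\<in>I. \<Sum>j\<in>I. v i * cnj (v j) * e_unit (t * (y i - y j)))"
proof -
  have "complex_of_real ((norm (\<Sum>i\<in>I. v i * e_unit (t * y i)))\<^sup>2)
    = (\<Sum>i\<in>I. v i * e_unit (t * y i)) * cnj (\<Sum>i\<in>I. v i * e_unit (t * y i))"
    by (rule complex_norm_square)
  also have "\<dots> = (\<Sum>i\<in>I. v i * e_unit (t * y i)) * (\<Sum>j\<in>I. cnj (v j) * e_unit (- (t * y j)))"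
    by (simp add: cnj_e_unit)
  also have "\<dots> = (\<Sum>i\<in>I. \<Sum>j\<in>I. v i * cnj (v j) * e_unit (t * (y i - y j)))"
    unfolding sum_product
    by (intro sum.cong refl) (simp add: right_diff_distrib flip: e_unit_add mult.assoc)
  finally show ?thesis .
qed

lemma symmetric_schur_bound:
  fixes a :: "'a \<Rightarrow> real" and k :: "'a \<Rightarrow> 'a \<Rightarrow> real"
  assumes k: "\<And>i j. 0 \<le> k i j" "\<And>i j. k i j = k j i"
    and B: "\<And>i. i \<in> I \<Longrightarrow> (\<Sum>j\<in>I. k i j) \<le> B"
  shows "(\<Sum>i\<in>I. \<Sum>j\<in>I. a i * a j * k i j) \<le> B * (\<Sum>i\<in>I. (a i)\<^sup>2)"
proof -
  have "(\<Sum>i\<in>I. \<Sum>j\<in>I. a i * a j * k i j) \<le> (\<Sum>i\<in>I. \<Sum>j\<in>I. (a i)\<^sup>2 * k i j / 2 + (a j)\<^sup>2 * k j i / 2)"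
  proof (intro sum_mono)
    fix i j
    have "2 * (a i * a j) \<le> (a i)\<^sup>2 + (a j)\<^sup>2"
      using sum_squares_bound[of "a i" "a j"] by (simp add: mult.assoc)
    from mult_right_mono[OF this k(1)[of i j]]
    show "a i * a j * k i j \<le> (a i)\<^sup>2 * k i j / 2 + (a j)\<^sup>2 * k j i / 2"
      using k(2)[of j i] by (simp add: algebra_simps)
  qed
  also have "\<dots> = (\<Sum>i\<in>I. \<Sum>j\<in>I. (a i)\<^sup>2 * k i j / 2) + (\<Sum>i\<in>I. \<Sum>j\<in>I. (a j)\<^sup>2 * k j i / 2)"
    by (simp add: sum.distrib)
  also have "(\<Sum>i\<in>I. \<Sum>j\<in>I. (a j)\<^sup>2 * k j i / 2) = (\<Sum>i\<in>I. \<Sum>j\<in>I. (a i)\<^sup>2 * k i j / 2)"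
    by (rule sum.swap)
  also have "(\<Sum>i\<in>I. \<Sum>j\<in>I. (a i)\<^sup>2 * k i j / 2) + \<dots> = (\<Sum>i\<in>I. (a i)\<^sup>2 * (\<Sum>j\<in>I. k i j))"
    unfolding sum_distrib_left sum.distrib[symmetric] by (intro sum.cong refl) simp
  also have "\<dots> \<le> (\<Sum>i\<in>I. (a i)\<^sup>2 * B)"
    by (intro sum_mono mult_left_mono B) auto
  also have "\<dots> = B * (\<Sum>i\<in>I. (a i)\<^sup>2)"
    by (simp add: sum_distrib_left mult.commute)
  finally show ?thesis .
qed

text \<open>The indicator function of the interval is replaced by a trapezoid that equals 1 on it and falls to
0 linearly over length \<open>L\<close>, about \<open>1/\<delta>\<close>: the average over \<open>b < L\<close> of indicator functions of shifts of
an interval with \<open>R = N + L - 1\<close> elements. Its Fourier transform is \<open>1/L\<close> times a product of two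
geometric sums, hence at most \<open>1 / (4 L dist_Z(\<theta>)\<^sup>2)\<close>. This decays fast enough for the off-diagonal
terms of the quadratic form to be summed with Schur's test; they contribute at most \<open>1/(L \<delta>\<^sup>2) \<le> 1/\<delta>\<close> to
each row, and the diagonal contributes \<open>R \<le> N + 1/\<delta>\<close>.\<close>

lemma dual_large_sieve:
  fixes y :: "'a \<Rightarrow> real" and v :: "'a \<Rightarrow> complex"
  assumes fin: "finite I" and \<delta>: "0 < \<delta>"
    and sp: "\<And>i j. i \<in> I \<Longrightarrow> j \<in> I \<Longrightarrow> i \<noteq> j \<Longrightarrow> \<delta> \<le> dist_Z (y i - y j)"
  shows "(\<Sum>n<N. (norm (\<Sum>i\<in>I. v i * e_unit ((c + real n) * y i)))\<^sup>2)
    \<le> (real N + 2 / \<delta>) * (\<Sum>i\<in>I. (norm (v i))\<^sup>2)"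
proof -
  define V where "V t = (norm (\<Sum>i\<in>I. v i * e_unit (t * y i)))\<^sup>2" for t
  define L where "L = nat \<lceil>1 / \<delta>\<rceil>"
  have "1 / \<delta> > 0" using \<delta> by simp
  then have L: "0 < L" "1 / \<delta> \<le> real L" "real L < 1 / \<delta> + 1"
    unfolding L_def by (linarith | simp)+
  define R where "R = N + L - 1"
  define c' where "c' = c - real L + 1"
  define D where "D \<theta> = (\<Sum>r<R. e_unit ((c + real r) * \<theta>))" for \<theta>
  define E where "E \<theta> = (\<Sum>b<L. e_unit ((real b) * - \<theta>))" for \<theta>
  define k where "k i j = (if i = j then real R else 1 / (4 * real L * (dist_Z (y i - y j))\<^sup>2))" for i j
  have V0: "0 \<le> V t" for t by (simp add: V_def)
  \<comment> \<open>Each shift of the long interval by \<open>b < L\<close> covers the given interval.\<close>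
  have "real L * (\<Sum>n<N. V (c + real n)) = (\<Sum>b<L. \<Sum>n<N. V (c + real n))"
    by simp
  also have "\<dots> \<le> (\<Sum>b<L. \<Sum>r<R. V (c + real r - real b))"
  proof (rule sum_mono)
    fix b assume "b \<in> {..<L}"
    then have "(\<lambda>n. n + b) ` {..<N} \<subseteq> {..<R}" by (auto simp: R_def)
    moreover have "(\<Sum>n<N. V (c + real n)) = (\<Sum>r\<in>(\<lambda>n. n + b) ` {..<N}. V (c + real r - real b))"
      by (simp add: sum.reindex)
    ultimately show "(\<Sum>n<N. V (c + real n)) \<le> (\<Sum>r<R. V (c + real r - real b))"
      using V0 by (auto intro!: sum_mono2)
  qed
  finally have le: "real L * (\<Sum>n<N. V (c + real n)) \<le> (\<Sum>b<L. \<Sum>r<R. V (c + real r - real b))" .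
  have "complex_of_real (\<Sum>b<L. \<Sum>r<R. V (c + real r - real b))
    = (\<Sum>b<L. \<Sum>r<R. \<Sum>i\<in>I. \<Sum>j\<in>I. v i * cnj (v j) * e_unit ((c + real r - real b) * (y i - y j)))"
    by (simp add: V_def of_real_sum_norm_squares_expand[OF fin] del: of_real_power)
  also have "\<dots> = (\<Sum>i\<in>I. \<Sum>j\<in>I. \<Sum>b<L. \<Sum>r<R. v i * cnj (v j) * e_unit ((c + real r - real b) * (y i - y j)))"
    by (simp only: sum.swap[where A = "{..<R}" and B = I] sum.swap[where A = "{..<L}" and B = I])
  also have "\<dots> = (\<Sum>i\<in>I. \<Sum>j\<in>I. v i * cnj (v j) * (E (y i - y j) * D (y i - y j)))"
  proof (intro sum.cong refl)
    fix i j
    have "e_unit ((c + real r - real b) * (y i - y j)) = e_unit (real b * - (y i - y j)) * e_unit ((c + real r) * (y i - y j))" for r b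
      by (simp add: algebra_simps flip: e_unit_add)
    then show "(\<Sum>b<L. \<Sum>r<R. v i * cnj (v j) * e_unit ((c + real r - real b) * (y i - y j)))
      = v i * cnj (v j) * (E (y i - y j) * D (y i - y j))"
      unfolding E_def D_def sum_product by (simp only: sum_distrib_left)
  qed
  finally have "complex_of_real (\<Sum>b<L. \<Sum>r<R. V (c + real r - real b))
    = (\<Sum>i\<in>I. \<Sum>j\<in>I. v i * cnj (v j) * (E (y i - y j) * D (y i - y j)))" .
  then have "norm (complex_of_real (\<Sum>b<L. \<Sum>r<R. V (c + real r - real b)))
    \<le> (\<Sum>i\<in>I. \<Sum>j\<in>I. norm (v i * cnj (v j) * (E (y i - y j) * D (y i - y j))))"
    by (simp only:) (intro order.trans[OF norm_sum] sum_mono order_refl)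
  moreover have "norm (complex_of_real (\<Sum>b<L. \<Sum>r<R. V (c + real r - real b))) = (\<Sum>b<L. \<Sum>r<R. V (c + real r - real b))"
    unfolding norm_of_real by (intro abs_of_nonneg sum_nonneg V0)
  moreover have "(\<Sum>i\<in>I. \<Sum>j\<in>I. norm (v i * cnj (v j) * (E (y i - y j) * D (y i - y j))))
    \<le> (\<Sum>i\<in>I. \<Sum>j\<in>I. norm (v i) * norm (v j) * (real L * k i j))"
  proof (intro sum_mono)
    fix i j assume ij: "i \<in> I" "j \<in> I"
    have "norm (E (y i - y j) * D (y i - y j)) \<le> real L * k i j"
    proof (cases "i = j")
      case True
      then show ?thesis by (simp add: E_def D_def k_def norm_mult)
    next
      case False
      then have pos: "0 < dist_Z (y i - y j)" using sp[OF ij] \<delta> by simp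
      have "norm (E (y i - y j)) \<le> 1 / (2 * dist_Z (y i - y j))"
        using norm_geometric_e_unit[of "- (y i - y j)" 0 L] pos
        unfolding E_def dist_Z_minus by simp
      moreover have "norm (D (y i - y j)) \<le> 1 / (2 * dist_Z (y i - y j))"
        using norm_geometric_e_unit[OF pos, of c R] by (simp add: D_def)
      ultimately have "norm (E (y i - y j) * D (y i - y j)) \<le> 1 / (2 * dist_Z (y i - y j)) * (1 / (2 * dist_Z (y i - y j)))"
        unfolding norm_mult by (intro mult_mono) (use pos in auto)
      then show ?thesis using False L(1) by (simp add: k_def power2_eq_square)
    qed
    then show "norm (v i * cnj (v j) * (E (y i - y j) * D (y i - y j))) \<le> norm (v i) * norm (v j) * (real L * k i j)"
      by (simp add: norm_mult mult.assoc mult_left_mono)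
  qed
  moreover have "(\<Sum>i\<in>I. \<Sum>j\<in>I. norm (v i) * norm (v j) * (real L * k i j))
     = real L * (\<Sum>i\<in>I. \<Sum>j\<in>I. norm (v i) * norm (v j) * k i j)"
    by (simp add: sum_distrib_left mult_ac)
  moreover have "(\<Sum>i\<in>I. \<Sum>j\<in>I. norm (v i) * norm (v j) * k i j) \<le> (real N + 2 / \<delta>) * (\<Sum>i\<in>I. (norm (v i))\<^sup>2)"
  proof (rule symmetric_schur_bound)
    show "0 \<le> k i j" for i j by (simp add: k_def)
    show "k i j = k j i" for i j using dist_Z_minus[of "y i - y j"] by (simp add: k_def)
    fix i assume i: "i \<in> I"
    have "(\<Sum>j\<in>I. k i j) = real R + (\<Sum>j\<in>I-{i}. 1 / (4 * real L * (dist_Z (y i - y j))\<^sup>2))"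
      using fin i by (subst sum.remove[OF fin i]) (auto simp: k_def intro!: sum.cong split: if_splits)
    also have "(\<Sum>j\<in>I-{i}. 1 / (4 * real L * (dist_Z (y i - y j))\<^sup>2))
      = (\<Sum>j\<in>I-{i}. 1 / (dist_Z (y i - y j))\<^sup>2) / (4 * real L)"
      by (simp add: sum_divide_distrib mult_ac)
    also have "\<dots> \<le> 4 / \<delta>\<^sup>2 / (4 * real L)"
      by (intro divide_right_mono spaced_sum_inverse_squares fin \<delta> sp i) auto
    also have "\<dots> = 1 / \<delta> * (1 / \<delta>) / real L" by (simp add: power2_eq_square)
    also have "\<dots> \<le> 1 / \<delta> * real L / real L"
      using L \<delta> by (intro divide_right_mono mult_left_mono) auto
    also have "\<dots> = 1 / \<delta>" using L by simp
    finally show "(\<Sum>j\<in>I. k i j) \<le> real N + 2 / \<delta>"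
      using L by (simp add: R_def of_nat_diff)
  qed
  ultimately have "real L * (\<Sum>n<N. V (c + real n)) \<le> real L * ((real N + 2 / \<delta>) * (\<Sum>i\<in>I. (norm (v i))\<^sup>2))"
    using le L(1) by (smt (verit) mult_left_mono of_nat_0_le_iff)
  then show ?thesis using L(1) by (simp add: V_def)
qed

definition exp_sum :: "nat set \<Rightarrow> (nat \<Rightarrow> complex) \<Rightarrow> real \<Rightarrow> complex" where
  "exp_sum S u x = (\<Sum>n\<in>S. u n * e_unit (x * real n))"

text \<open>This is the dual form above with the coefficients \<open>v i\<close> equal to the conjugates of the values of the
exponential sum, by Cauchy-Schwarz. The points are indexed by a family, so that the fractions \<open>x + a/q\<close>
can be indexed by triples.\<close>

theorem large_sieve:
  fixes y :: "'a \<Rightarrow> real"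
  assumes fin: "finite I" and \<delta>: "0 < \<delta>"
    and sp: "\<And>i j. i \<in> I \<Longrightarrow> j \<in> I \<Longrightarrow> i \<noteq> j \<Longrightarrow> \<delta> \<le> dist_Z (y i - y j)"
    and S: "S \<subseteq> {m..<m + N}"
  shows "(\<Sum>i\<in>I. (norm (exp_sum S u (y i)))\<^sup>2) \<le> (real N + 2 / \<delta>) * (\<Sum>n\<in>S. (norm (u n))\<^sup>2)"
proof -
  define W where "W = (\<Sum>i\<in>I. (norm (exp_sum S u (y i)))\<^sup>2)"
  define v where "v i = cnj (exp_sum S u (y i))" for i
  define V where "V n = (\<Sum>i\<in>I. v i * e_unit (real n * y i))" for n :: nat
  have "finite S" using S finite_subset by blast
  have W0: "0 \<le> W" by (simp add: W_def sum_nonneg)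
  have "complex_of_real W = (\<Sum>i\<in>I. exp_sum S u (y i) * v i)"
    by (simp add: W_def v_def complex_norm_square del: of_real_power)
  also have "\<dots> = (\<Sum>i\<in>I. \<Sum>n\<in>S. u n * (v i * e_unit (real n * y i)))"
    by (simp add: exp_sum_def sum_distrib_left sum_distrib_right mult_ac)
  also have "\<dots> = (\<Sum>n\<in>S. u n * V n)"
    by (subst sum.swap) (simp add: V_def sum_distrib_left)
  finally have "W = norm (\<Sum>n\<in>S. u n * V n)"
    using W0 by (metis abs_of_nonneg norm_of_real)
  also have "\<dots> \<le> (\<Sum>n\<in>S. norm (u n) * norm (V n))"
    by (rule order.trans[OF norm_sum]) (simp add: norm_mult)
  finally have "W\<^sup>2 \<le> (\<Sum>n\<in>S. norm (u n) * norm (V n))\<^sup>2"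
    using W0 by (intro power_mono)
  also have "\<dots> \<le> (\<Sum>n\<in>S. (norm (u n))\<^sup>2) * (\<Sum>n\<in>S. (norm (V n))\<^sup>2)"
    by (rule Cauchy_Schwarz_ineq_sum)
  also have "\<dots> \<le> (\<Sum>n\<in>S. (norm (u n))\<^sup>2) * ((real N + 2 / \<delta>) * W)"
  proof (rule mult_left_mono)
    have "(\<Sum>n\<in>S. (norm (V n))\<^sup>2) \<le> (\<Sum>n\<in>{m..<m+N}. (norm (V n))\<^sup>2)"
      using S by (intro sum_mono2) auto
    also have "\<dots> = (\<Sum>n<N. (norm (V (m + n)))\<^sup>2)"
      using sum.shift_bounds_nat_ivl[of "\<lambda>n. (norm (V n))\<^sup>2" 0 m N]
      by (simp add: add.commute atLeast0LessThan)
    also have "\<dots> \<le> (real N + 2 / \<delta>) * (\<Sum>i\<in>I. (norm (v i))\<^sup>2)"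
      using dual_large_sieve[OF fin \<delta> sp, where v = v and c = "real m" and N = N] by (simp add: V_def)
    finally show "(\<Sum>n\<in>S. (norm (V n))\<^sup>2) \<le> (real N + 2 / \<delta>) * W"
      by (simp add: W_def v_def)
  qed (simp add: sum_nonneg)
  finally have *: "W * W \<le> ((real N + 2 / \<delta>) * (\<Sum>n\<in>S. (norm (u n))\<^sup>2)) * W"
    by (simp add: power2_eq_square mult_ac)
  show ?thesis
  proof (cases "W = 0")
    case True
    then show ?thesis using \<delta> by (simp add: W_def[symmetric] sum_nonneg)
  next
    case False
    with W0 * show ?thesis by (simp add: W_def[symmetric])
  qed
qed

section \<open>Ramanujan sums and the sifted large sieve\<close>

definition ramanujan_sum :: "nat \<Rightarrow> int \<Rightarrow> complex" where
  "ramanujan_sum q n = (\<Sum>a\<in>totatives q. e_unit (real_of_int n * real a / real q))"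

lemma e_unit_add_of_int: "e_unit (t + real_of_int k) = e_unit t"
  by (simp add: e_unit_add e_unit_of_int)

lemma sum_all_fractions:
  assumes "q > 1"
  shows "(\<Sum>a\<in>{0<..q}. e_unit (real a / real q)) = 0"
proof -
  define w where "w = e_unit (1 / real q)"
  have wq: "w ^ q = 1"
    using e_unit_power[of q "1 / real q"] e_unit_of_int[of 1] assms by (simp add: w_def)
  have "w \<noteq> 1"
  proof
    assume "w = 1"
    then have "dist_Z (1 / real q) \<le> 0"
      using norm_one_minus_e_unit[of "1 / real q"] by (simp add: w_def)
    then obtain k where k: "1 / real q = real_of_int k"
      using dist_Z_attained[of "1 / real q"] by (metis abs_le_zero_iff eq_iff_diff_eq_0)
    have "0 < real_of_int k" "real_of_int k < 1" using assms unfolding k[symmetric] by auto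
    then show False by simp
  qed
  have image: "{0<..q} = Suc ` {..<q}"
    by (auto simp: image_iff Suc_le_eq gr0_conv_Suc)
  have "(\<Sum>a\<in>{0<..q}. e_unit (real a / real q)) = (\<Sum>a\<in>{0<..q}. w ^ a)"
    by (simp add: w_def flip: e_unit_power)
  also have "\<dots> = w * (\<Sum>a<q. w ^ a)"
    unfolding image by (simp add: sum.reindex sum_distrib_left)
  also have "(\<Sum>a<q. w ^ a) = 0"
    using \<open>w \<noteq> 1\<close> wq by (simp add: sum_gp_strict)
  finally show ?thesis by simp
qed

text \<open>Sorting the fractions \<open>a/q\<close> by their reduced denominator \<open>d\<close> splits the sum of all \<open>q\<close>-th roots of unity,
which vanishes for \<open>q > 1\<close>, into Ramanujan sums.\<close>

lemma sum_ramanujan_sum_divisors: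
  assumes "q > 0"
  shows "(\<Sum>d | d dvd q. ramanujan_sum d 1) = (if q = 1 then 1 else 0)"
proof -
  have "(\<Sum>a\<in>{0<..q}. e_unit (real a / real q))
     = (\<Sum>d | d dvd q. \<Sum>a | a \<in> {0<..q} \<and> gcd a q = q div d. e_unit (real a / real q))"
  proof -
    have div_div: "q div (q div d) = d" if "d dvd q" for d
      using that assms by (auto elim!: dvdE)
    have fin: "finite {d. d dvd q}" using assms by simp
    have "(\<Sum>d | d dvd q. \<Sum>a | a \<in> {0<..q} \<and> gcd a q = q div d. e_unit (real a / real q))
       = (\<Sum>a\<in>(\<Union>d\<in>{d. d dvd q}. {a \<in> {0<..q}. gcd a q = q div d}). e_unit (real a / real q))"
    proof (rule sum.UNION_disjoint[symmetric])
      show "\<forall>i\<in>{d. d dvd q}. \<forall>j\<in>{d. d dvd q}. i \<noteq> j \<longrightarrow>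
        {a \<in> {0<..q}. gcd a q = q div i} \<inter> {a \<in> {0<..q}. gcd a q = q div j} = {}"
      proof (intro ballI impI)
        fix i j assume "i \<in> {d. d dvd q}" "j \<in> {d. d dvd q}" "i \<noteq> j"
        then have "q div i \<noteq> q div j" using div_div[of i] div_div[of j] by force
        then show "{a \<in> {0<..q}. gcd a q = q div i} \<inter> {a \<in> {0<..q}. gcd a q = q div j} = {}"
          by auto
      qed
    qed (use fin in auto)
    also have "(\<Union>d\<in>{d. d dvd q}. {a \<in> {0<..q}. gcd a q = q div d}) = {0<..q}"
    proof (intro equalityI subsetI)
      fix a assume "a \<in> {0<..q}"
      moreover have "q div (q div gcd a q) = gcd a q"
        by (rule div_div) simp
      moreover have "q div gcd a q dvd q" by (metis dvd_div_mult_self dvd_triv_left gcd_dvd2)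
      ultimately show "a \<in> (\<Union>d\<in>{d. d dvd q}. {a \<in> {0<..q}. gcd a q = q div d})" by force
    qed auto
    finally show ?thesis by simp
  qed
  also have "\<dots> = (\<Sum>d | d dvd q. ramanujan_sum d 1)"
  proof (rule sum.cong)
    fix d assume "d \<in> {d. d dvd q}"
    then obtain c where c: "q = d * c" by auto
    then have pos: "c > 0" "d > 0" using assms by auto
    have bij: "bij_betw (\<lambda>k. k * c) (totatives d) {a\<in>{0<..q}. gcd a q = c}"
      using bij_betw_totatives_gcd_eq[of c q] assms c pos by simp
    have "(\<Sum>a | a \<in> {0<..q} \<and> gcd a q = c. e_unit (real a / real q))
      = (\<Sum>a\<in>totatives d. e_unit (real (a * c) / real q))"
      using sum.reindex_bij_betw[OF bij, of "\<lambda>a. e_unit (real a / real q)"] by simp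
    then show "(\<Sum>a | a \<in> {0<..q} \<and> gcd a q = q div d. e_unit (real a / real q)) = ramanujan_sum d 1"
      using pos by (simp add: ramanujan_sum_def c)
  qed simp
  finally have "(\<Sum>d | d dvd q. ramanujan_sum d 1) = (\<Sum>a\<in>{0<..q}. e_unit (real a / real q))" ..
  also have "\<dots> = (if q = 1 then 1 else 0)"
  proof (cases "q = 1")
    case True
    then have "{0<..q} = {1}" by auto
    then show ?thesis using True e_unit_of_int[of 1] by simp
  qed (use sum_all_fractions[of q] assms in simp)
  finally show ?thesis .
qed

text \<open>The divisors of \<open>p m\<close> are the \<open>d\<close> and the \<open>p d\<close> with \<open>d\<close> dividing \<open>m\<close>. In the divisor sum, which is 0, the
pairs \<open>d\<close>, \<open>p d\<close> with \<open>d < m\<close> cancel by induction, so the pair \<open>m\<close>, \<open>p m\<close> cancels too. Iterated, this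
gives the value \<open>\<mu>(m)\<close> for squarefree \<open>m\<close>.\<close>

lemma ramanujan_sum_prime_mult:
  assumes p: "prime p" and "\<not> p dvd m" "m > 0"
  shows "ramanujan_sum (p * m) 1 = - ramanujan_sum m 1"
  using assms(2,3)
proof (induction m rule: less_induct)
  case (less m)
  have split: "{d. d dvd p * m} = {d. d dvd m} \<union> (\<lambda>d. p * d) ` {d. d dvd m}"
  proof (intro equalityI subsetI)
    fix d assume "d \<in> {d. d dvd p * m}"
    then have d: "d dvd p * m" by simp
    show "d \<in> {d. d dvd m} \<union> (\<lambda>d. p * d) ` {d. d dvd m}"
    proof (cases "p dvd d")
      case True
      then obtain e where "d = p * e" by auto
      then show ?thesis using d prime_gt_0_nat[OF p] by auto
    next
      case False
      then have "coprime d p" using p prime_imp_coprime coprime_commute by blast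
      then show ?thesis using d by (simp add: coprime_dvd_mult_right_iff)
    qed
  qed auto
  have disj: "{d. d dvd m} \<inter> (\<lambda>d. p * d) ` {d. d dvd m} = {}"
    using less.prems by (auto dest: dvd_mult_left)
  have fin: "finite {d. d dvd m}" using less.prems by simp
  have inj: "inj_on (\<lambda>d. p * d) {d. d dvd m}" using prime_gt_0_nat[OF p] by (auto intro: inj_onI)
  have "p * m \<noteq> 1" using prime_gt_1_nat[OF p] by auto
  moreover have "p * m > 0" using less.prems prime_gt_0_nat[OF p] by auto
  ultimately have "0 = (\<Sum>d | d dvd p * m. ramanujan_sum d 1)"
    using sum_ramanujan_sum_divisors[of "p * m"] by auto
  also have "\<dots> = (\<Sum>d | d dvd m. ramanujan_sum d 1) + (\<Sum>d | d dvd m. ramanujan_sum (p * d) 1)"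
    unfolding split using disj fin inj by (subst sum.union_disjoint) (auto simp: sum.reindex)
  also have "\<dots> = (\<Sum>d | d dvd m. ramanujan_sum d 1 + ramanujan_sum (p * d) 1)"
    by (simp add: sum.distrib)
  also have "\<dots> = (\<Sum>d\<in>{m}. ramanujan_sum d 1 + ramanujan_sum (p * d) 1)"
  proof (rule sum.mono_neutral_right)
    show "\<forall>d\<in>{d. d dvd m} - {m}. ramanujan_sum d 1 + ramanujan_sum (p * d) 1 = 0"
    proof
      fix d assume d: "d \<in> {d. d dvd m} - {m}"
      then have "d dvd m" "d \<noteq> m" by auto
      then have "d < m" "d > 0" "\<not> p dvd d"
        using less.prems dvd_imp_le[of d m] by (auto dest: dvd_trans intro: Nat.gr0I)
      then show "ramanujan_sum d 1 + ramanujan_sum (p * d) 1 = 0"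
        using less.IH[of d] by simp
    qed
  qed (use fin in auto)
  finally show ?case by (simp add: eq_neg_iff_add_eq_0 add.commute)
qed

lemma squarefree_prime_dvd:
  fixes q :: nat
  assumes "squarefree q" "prime p" "p dvd q"
  obtains m where "q = p * m" "\<not> p dvd m"
proof -
  obtain m where m: "q = p * m" using assms by auto
  have "\<not> p dvd m"
  proof
    assume "p dvd m"
    then have "p\<^sup>2 dvd q" using m by (simp add: power2_eq_square mult_dvd_mono)
    then show False using squarefreeD[OF assms(1), of p] assms by auto
  qed
  with m show ?thesis using that by blast
qed

lemma squarefree_nat_induct [consumes 1, case_names one mult]:
  assumes "squarefree (q::nat)"
    and one: "P 1"
    and mult: "\<And>p m. prime p \<Longrightarrow> \<not> p dvd m \<Longrightarrow> squarefree m \<Longrightarrow> P m \<Longrightarrow> P (p * m)"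
  shows "P q"
  using assms(1)
proof (induction q rule: less_induct)
  case (less q)
  have "q > 0" using less.prems not_squarefree_0[where 'a = nat] by (metis gr0I)
  show ?case
  proof (cases "q = 1")
    case False
    then obtain p where p: "prime p" "p dvd q" using prime_factor_nat by blast
    obtain m where m: "q = p * m" and "\<not> p dvd m"
      using squarefree_prime_dvd[OF less.prems p] .
    moreover have "m < q" using \<open>q > 0\<close> prime_gt_1_nat[OF p(1)] m by auto
    moreover have "squarefree m" using less.prems m by (metis dvd_triv_right squarefree_mono)
    ultimately show ?thesis using mult p m less.IH by blast
  qed (use one in simp)
qed

text \<open>Multiplication by a unit permutes the reduced residues.\<close>

lemma ramanujan_sum_coprime:
  assumes q: "q > 0" and cop: "coprime n (int q)"
  shows "ramanujan_sum q n = ramanujan_sum q 1"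
proof -
  define f where "f a = (if q = 1 then 1 else nat ((n * int a) mod int q))" for a
  show ?thesis
  proof (cases "q = 1")
    case True
    then show ?thesis using e_unit_of_int[of n] e_unit_of_int[of 1] by (simp add: ramanujan_sum_def)
  next
    case False
    with q have q1: "q > 1" by simp
    have int_f: "int (f a) = (n * int a) mod int q" for a using q1 by (simp add: f_def)
    have maps: "f a \<in> totatives q" if "a \<in> totatives q" for a
    proof -
      have "coprime (int a) (int q)" using that by (simp add: in_totatives_iff)
      then have "coprime (n * int a) (int q)" using cop by simp
      then have "coprime (int (f a)) (int q)" unfolding int_f using q1 by simp
      then have "coprime (f a) q" by simp
      moreover have "f a \<noteq> 0" using \<open>coprime (f a) q\<close> q1 by (intro notI) simp
      moreover have "int (f a) < int q" unfolding int_f using q1 by simp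
      ultimately show ?thesis by (simp add: in_totatives_iff)
    qed
    have inj: "inj_on f (totatives q)"
    proof (rule inj_onI)
      fix a b assume ab: "a \<in> totatives q" "b \<in> totatives q" "f a = f b"
      then have "(n * int a) mod int q = (n * int b) mod int q" by (metis int_f)
      then have "int q dvd n * (int a - int b)" by (simp add: mod_eq_dvd_iff right_diff_distrib)
      then have "int q dvd int a - int b" using cop by (simp add: coprime_dvd_mult_right_iff coprime_commute)
      moreover have "a < q" "b < q" using ab q1 totatives_less by auto
      ultimately show "a = b" using mod_eq_dvd_iff[of "int a" "int q" "int b"] by simp
    qed
    have "f ` totatives q = totatives q"
      using maps inj by (intro endo_inj_surj) auto
    then have "ramanujan_sum q 1 = (\<Sum>a\<in>totatives q. e_unit (real (f a) / real q))"
      using sum.reindex[OF inj, of "\<lambda>a. e_unit (real a / real q)"] by (simp add: ramanujan_sum_def)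
    also have "\<dots> = ramanujan_sum q n"
      unfolding ramanujan_sum_def
    proof (rule sum.cong)
      fix a assume "a \<in> totatives q"
      have "real_of_int (n * int a) = real_of_int ((n * int a) div int q * int q + int (f a))"
        unfolding int_f by simp
      then have "real_of_int n * real a / real q = real (f a) / real q + real_of_int ((n * int a) div int q)"
        using q1 by (simp add: field_simps)
      then show "e_unit (real (f a) / real q) = e_unit (real_of_int n * real a / real q)"
        by (simp add: e_unit_add_of_int)
    qed simp
    finally show ?thesis ..
  qed
qed

lemma norm_ramanujan_sum_squarefree:
  assumes "squarefree q" "coprime n (int q)"
  shows "norm (ramanujan_sum q n) = 1"
proof -
  have "norm (ramanujan_sum q 1) = 1"
    using assms(1)
  proof (induction q rule: squarefree_nat_induct)
    case one
    show ?case using e_unit_of_int[of 1] by (simp add: ramanujan_sum_def)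
  next
    case (mult p m)
    then show ?case by (cases "m = 0") (simp_all add: ramanujan_sum_prime_mult)
  qed
  moreover have "q > 0" using assms(1) not_squarefree_0[where 'a = nat] by (metis gr0I)
  ultimately show ?thesis using ramanujan_sum_coprime[OF _ assms(2)] by simp
qed

text \<open>If \<open>q\<close> is coprime to the support, summing the shifted sums over the reduced residues \<open>a\<close> multiplies
every term by the same Ramanujan sum, a number of absolute value 1. Cauchy-Schwarz then compares
the sum of the \<open>\<phi>(q)\<close> shifted sums with the sum of their squares.\<close>

lemma exp_sum_sifted:
  assumes q: "squarefree q" and cop: "\<And>n. n \<in> S \<Longrightarrow> coprime n q"
  shows "(norm (exp_sum S u x))\<^sup>2 / real (totient q)
    \<le> (\<Sum>a\<in>totatives q. (norm (exp_sum S u (x + real a / real q)))\<^sup>2)"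
proof -
  have q0: "q > 0" using q not_squarefree_0[where 'a = nat] by (metis gr0I)
  have "(\<Sum>a\<in>totatives q. exp_sum S u (x + real a / real q))
    = (\<Sum>n\<in>S. u n * e_unit (x * real n) * ramanujan_sum q (int n))"
  proof -
    have "e_unit ((x + real a / real q) * real n)
        = e_unit (x * real n) * e_unit (real_of_int (int n) * real a / real q)" for a n
      unfolding e_unit_add[symmetric] by (rule arg_cong[of _ _ e_unit]) (simp add: distrib_right)
    then show ?thesis
      unfolding exp_sum_def ramanujan_sum_def
      by (subst sum.swap) (simp add: sum_distrib_left mult.assoc)
  qed
  also have "\<dots> = (\<Sum>n\<in>S. u n * e_unit (x * real n) * ramanujan_sum q 1)"
  proof (intro sum.cong refl)
    fix n assume "n \<in> S"
    then have "ramanujan_sum q (int n) = ramanujan_sum q 1"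
      using cop by (intro ramanujan_sum_coprime q0) simp
    then show "u n * e_unit (x * real n) * ramanujan_sum q (int n)
      = u n * e_unit (x * real n) * ramanujan_sum q 1" by simp
  qed
  also have "\<dots> = exp_sum S u x * ramanujan_sum q 1"
    by (simp add: exp_sum_def sum_distrib_right)
  finally have "(norm (exp_sum S u x))\<^sup>2 = (norm (\<Sum>a\<in>totatives q. exp_sum S u (x + real a / real q)))\<^sup>2"
    using norm_ramanujan_sum_squarefree[OF q, of 1] by (simp add: norm_mult)
  also have "\<dots> \<le> (\<Sum>a\<in>totatives q. 1 * norm (exp_sum S u (x + real a / real q)))\<^sup>2"
    by (intro power_mono order.trans[OF norm_sum]) auto
  also have "\<dots> \<le> (\<Sum>a\<in>totatives q. 1\<^sup>2) * (\<Sum>a\<in>totatives q. (norm (exp_sum S u (x + real a / real q)))\<^sup>2)"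
    by (rule Cauchy_Schwarz_ineq_sum)
  also have "(\<Sum>a\<in>totatives q. 1\<^sup>2) = real (totient q)"
    by (simp add: totient_def)
  finally show ?thesis using q0 by (simp add: divide_le_eq mult.commute)
qed

text \<open>The set of moduli may depend on the point \<open>x\<close>; this freedom is used to avoid collisions between the
fractions attached to different points.\<close>

lemma sifted_large_sieve:
  assumes fin: "finite X" "\<And>x. x \<in> X \<Longrightarrow> finite (Q x)" and \<delta>: "0 < \<delta>"
    and sqf: "\<And>x q. x \<in> X \<Longrightarrow> q \<in> Q x \<Longrightarrow> squarefree q"
    and cop: "\<And>x q n. x \<in> X \<Longrightarrow> q \<in> Q x \<Longrightarrow> n \<in> S \<Longrightarrow> coprime n q"
    and sp: "\<And>x q a x' q' a'. x \<in> X \<Longrightarrow> q \<in> Q x \<Longrightarrow> a \<in> totatives q \<Longrightarrow>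
       x' \<in> X \<Longrightarrow> q' \<in> Q x' \<Longrightarrow> a' \<in> totatives q' \<Longrightarrow> (x, q, a) \<noteq> (x', q', a') \<Longrightarrow>
       \<delta> \<le> dist_Z ((x + real a / real q) - (x' + real a' / real q'))"
    and S: "S \<subseteq> {m..<m + N}"
  shows "(\<Sum>x\<in>X. (\<Sum>q\<in>Q x. 1 / real (totient q)) * (norm (exp_sum S u x))\<^sup>2)
    \<le> (real N + 2 / \<delta>) * (\<Sum>n\<in>S. (norm (u n))\<^sup>2)"
proof -
  define I where "I = Sigma X (\<lambda>x. Sigma (Q x) totatives)"
  define y where "y = (\<lambda>(x, q, a). x + real a / real q)"
  have "(\<Sum>x\<in>X. (\<Sum>q\<in>Q x. 1 / real (totient q)) * (norm (exp_sum S u x))\<^sup>2)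
    \<le> (\<Sum>x\<in>X. \<Sum>q\<in>Q x. \<Sum>a\<in>totatives q. (norm (exp_sum S u (x + real a / real q)))\<^sup>2)"
    unfolding sum_distrib_right
    using exp_sum_sifted sqf cop by (intro sum_mono) simp
  also have "\<dots> = (\<Sum>i\<in>I. (norm (exp_sum S u (y i)))\<^sup>2)"
    unfolding I_def y_def using fin by (simp add: sum.Sigma split_def)
  also have "\<dots> \<le> (real N + 2 / \<delta>) * (\<Sum>n\<in>S. (norm (u n))\<^sup>2)"
  proof (rule large_sieve[OF _ \<delta> _ S])
    show "finite I" unfolding I_def using fin by auto
    fix i j assume "i \<in> I" "j \<in> I" "i \<noteq> j"
    then show "\<delta> \<le> dist_Z (y i - y j)"
      by (cases i, cases j) (auto simp: I_def y_def simp del: diff_add_eq intro!: sp)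
  qed
  finally show ?thesis .
qed

section \<open>Reciprocal sums over numbers with prescribed prime factors\<close>

definition numbers_over :: "nat set \<Rightarrow> nat \<Rightarrow> nat set" where
  "numbers_over P y = {n. 0 < n \<and> n \<le> y \<and> prime_factors n \<subseteq> P}"

definition recip_sum :: "nat set \<Rightarrow> nat \<Rightarrow> real" where
  "recip_sum P y = (\<Sum>n\<in>numbers_over P y. 1 / real n)"

definition sqfree_over :: "nat set \<Rightarrow> nat \<Rightarrow> nat set" where
  "sqfree_over P y = {q \<in> numbers_over P y. squarefree q}"

definition totient_sum :: "nat set \<Rightarrow> nat \<Rightarrow> real" where
  "totient_sum P y = (\<Sum>q\<in>sqfree_over P y. 1 / real (totient q))"

lemma finite_numbers_over [simp]: "finite (numbers_over P y)"
  by (rule finite_subset[of _ "{..y}"]) (auto simp: numbers_over_def)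

lemma finite_sqfree_over [simp]: "finite (sqfree_over P y)"
  by (simp add: sqfree_over_def)

lemma numbers_over_pos: "n \<in> numbers_over P y \<Longrightarrow> 0 < n"
  by (simp add: numbers_over_def)

lemma numbers_over_mono: "P \<subseteq> P' \<Longrightarrow> y \<le> y' \<Longrightarrow> numbers_over P y \<subseteq> numbers_over P' y'"
  by (auto simp: numbers_over_def)

lemma recip_sum_mono: "P \<subseteq> P' \<Longrightarrow> y \<le> y' \<Longrightarrow> recip_sum P y \<le> recip_sum P' y'"
  unfolding recip_sum_def by (intro sum_mono2 numbers_over_mono) auto

lemma recip_sum_nonneg: "0 \<le> recip_sum P y"
  by (simp add: recip_sum_def sum_nonneg)

lemma totient_sum_nonneg: "0 \<le> totient_sum P y"
  by (simp add: totient_sum_def sum_nonneg)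

lemma prime_factors_prime_mult:
  fixes p :: nat
  assumes "prime p" "m > 0"
  shows "prime_factors (p * m) = insert p (prime_factors m)"
  using assms by (subst prime_factors_product) (auto simp: prime_prime_factors)

lemma mem_numbers_over_mult:
  assumes p: "prime p" and "p \<in> P"
  shows "p * m \<in> numbers_over P y \<longleftrightarrow> m \<in> numbers_over P (y div p)"
proof (cases "m = 0")
  case False
  have "p * m \<le> y \<longleftrightarrow> m \<le> y div p"
    using prime_gt_0_nat[OF p] by (simp add: less_eq_div_iff_mult_less_eq mult.commute)
  then show ?thesis
    using False assms prime_gt_0_nat[OF p] by (simp add: numbers_over_def prime_factors_prime_mult)
qed (simp add: numbers_over_def)

lemma mem_numbers_over_insert:
  assumes "prime p" "\<not> p dvd n"
  shows "n \<in> numbers_over (insert p P) y \<longleftrightarrow> n \<in> numbers_over P y"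
  using assms by (auto simp: numbers_over_def in_prime_factors_iff)

lemma not_dvd_numbers_over: "p \<notin> P \<Longrightarrow> prime p \<Longrightarrow> n \<in> numbers_over P y \<Longrightarrow> \<not> p dvd n"
  by (auto simp: numbers_over_def in_prime_factors_iff)

lemma numbers_over_insert:
  assumes p: "prime p" "p \<notin> P"
  shows "numbers_over (insert p P) y
    = numbers_over P y \<union> (*) p ` numbers_over (insert p P) (y div p)"
proof (intro equalityI subsetI)
  fix n assume n: "n \<in> numbers_over (insert p P) y"
  show "n \<in> numbers_over P y \<union> (*) p ` numbers_over (insert p P) (y div p)"
  proof (cases "p dvd n")
    case True
    then show ?thesis using n p mem_numbers_over_mult[of p "insert p P"] by auto
  qed (use n p mem_numbers_over_insert in auto)
next
  fix n assume "n \<in> numbers_over P y \<union> (*) p ` numbers_over (insert p P) (y div p)"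
  then show "n \<in> numbers_over (insert p P) y"
    using numbers_over_mono[of P "insert p P" y y] p mem_numbers_over_mult[of p "insert p P"] by auto
qed

lemma recip_sum_insert:
  assumes p: "prime p" "p \<notin> P"
  shows "recip_sum (insert p P) y = recip_sum P y + recip_sum (insert p P) (y div p) / real p"
proof -
  have disj: "numbers_over P y \<inter> (*) p ` numbers_over (insert p P) (y div p) = {}"
    using not_dvd_numbers_over[OF p(2,1)] dvd_triv_left by blast
  have "inj_on ((*) p) A" for A using prime_gt_0_nat[OF p(1)] by (auto intro: inj_onI)
  then show ?thesis
    unfolding recip_sum_def numbers_over_insert[OF p, of y] using disj
    by (subst sum.union_disjoint) (auto simp: sum.reindex sum_divide_distrib mult.commute[of "real p"])
qed

lemma mem_sqfree_over_mult:
  assumes p: "prime p" and "\<not> p dvd m" "p \<in> P"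
  shows "p * m \<in> sqfree_over P y \<longleftrightarrow> m \<in> sqfree_over (P - {p}) (y div p)"
proof -
  have "coprime p m" using assms by (simp add: prime_imp_coprime)
  then have "squarefree (p * m) \<longleftrightarrow> squarefree m"
    using p by (auto intro: squarefree_mult_coprime squarefree_prime squarefree_mono[of m "p * m"])
  moreover have "m \<in> numbers_over P (y div p) \<longleftrightarrow> m \<in> numbers_over (P - {p}) (y div p)"
    using assms mem_numbers_over_insert[of p m "P - {p}" "y div p"] by (simp add: insert_absorb)
  ultimately show ?thesis
    using assms mem_numbers_over_mult[of p P m y] by (simp add: sqfree_over_def)
qed

lemma totient_sum_multiples:
  assumes p: "prime p" "p \<in> P"
  shows "(\<Sum>q\<in>{q\<in>sqfree_over P y. p dvd q}. 1 / real (totient q))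
    = totient_sum (P - {p}) (y div p) / real (p - 1)"
proof -
  have eq: "{q\<in>sqfree_over P y. p dvd q} = (*) p ` sqfree_over (P - {p}) (y div p)"
  proof (intro equalityI subsetI)
    fix q assume q: "q \<in> {q\<in>sqfree_over P y. p dvd q}"
    then obtain m where "q = p * m" "\<not> p dvd m"
      using squarefree_prime_dvd[of q p] p by (auto simp: sqfree_over_def)
    then show "q \<in> (*) p ` sqfree_over (P - {p}) (y div p)"
      using q mem_sqfree_over_mult[of p m P y] p by auto
  next
    fix q assume "q \<in> (*) p ` sqfree_over (P - {p}) (y div p)"
    then obtain m where "q = p * m" "m \<in> sqfree_over (P - {p}) (y div p)" by auto
    moreover from this have "\<not> p dvd m"
      using not_dvd_numbers_over[of p "P - {p}" m] p by (auto simp: sqfree_over_def)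
    ultimately show "q \<in> {q\<in>sqfree_over P y. p dvd q}"
      using mem_sqfree_over_mult[of p m P y] p by auto
  qed
  have "inj_on ((*) p) A" for A using prime_gt_0_nat[OF p(1)] by (auto intro: inj_onI)
  then have "(\<Sum>q\<in>{q\<in>sqfree_over P y. p dvd q}. 1 / real (totient q))
     = (\<Sum>m\<in>sqfree_over (P - {p}) (y div p). 1 / real (totient (p * m)))"
    unfolding eq by (simp add: sum.reindex)
  also have "\<dots> = (\<Sum>m\<in>sqfree_over (P - {p}) (y div p). 1 / real (totient m) / real (p - 1))"
  proof (intro sum.cong refl)
    fix m assume "m \<in> sqfree_over (P - {p}) (y div p)"
    then have "\<not> p dvd m"
      using not_dvd_numbers_over[of p "P - {p}" m] p by (auto simp: sqfree_over_def)
    then have "coprime p m" using p by (simp add: prime_imp_coprime)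
    then have "totient (p * m) = (p - 1) * totient m"
      using p by (simp add: totient_mult_coprime totient_prime)
    then show "1 / real (totient (p * m)) = 1 / real (totient m) / real (p - 1)"
      by (simp add: mult.commute)
  qed
  finally show ?thesis by (simp add: totient_sum_def sum_divide_distrib)
qed

lemma sqfree_over_mono: "P \<subseteq> P' \<Longrightarrow> y \<le> y' \<Longrightarrow> sqfree_over P y \<subseteq> sqfree_over P' y'"
  using numbers_over_mono[of P P' y y'] by (auto simp: sqfree_over_def)

text \<open>A multiple of \<open>p\<close> is \<open>p m\<close> with \<open>m\<close> again admissible, and \<open>\<phi>(p m) = (p - 1) \<phi>(m)\<close>. This bounds the loss
caused by discarding the multiples of \<open>p\<close> from a set of moduli.\<close>

lemma totient_sum_multiples_le:
  assumes p: "prime p"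
  shows "(\<Sum>q\<in>{q\<in>sqfree_over P y. p dvd q}. 1 / real (totient q)) \<le> totient_sum P y / real (p - 1)"
proof (cases "p \<in> P")
  case True
  have "totient_sum (P - {p}) (y div p) \<le> totient_sum P y"
    unfolding totient_sum_def by (intro sum_mono2 sqfree_over_mono) auto
  then show ?thesis using totient_sum_multiples[OF p True] by (simp add: divide_right_mono)
next
  case False
  then have "{q\<in>sqfree_over P y. p dvd q} = {}"
    using not_dvd_numbers_over[OF False p] by (auto simp: sqfree_over_def)
  then show ?thesis by (simp only:) (simp add: totient_sum_nonneg)
qed

lemma totient_sum_insert:
  assumes p: "prime p" "p \<notin> P"
  shows "totient_sum (insert p P) y = totient_sum P y + totient_sum P (y div p) / real (p - 1)"
proof -
  have "sqfree_over (insert p P) y = sqfree_over P y \<union> {q\<in>sqfree_over (insert p P) y. p dvd q}"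
    using sqfree_over_mono[of P "insert p P" y y] mem_numbers_over_insert[OF p(1)]
    by (auto simp: sqfree_over_def)
  moreover have "sqfree_over P y \<inter> {q\<in>sqfree_over (insert p P) y. p dvd q} = {}"
    using not_dvd_numbers_over[OF p(2,1)] by (auto simp: sqfree_over_def)
  ultimately have "totient_sum (insert p P) y
    = totient_sum P y + (\<Sum>q\<in>{q\<in>sqfree_over (insert p P) y. p dvd q}. 1 / real (totient q))"
    unfolding totient_sum_def by (metis (no_types, lifting) finite_Un finite_sqfree_over sum.union_disjoint)
  also have "\<dots> = totient_sum P y + totient_sum P (y div p) / real (p - 1)"
    using totient_sum_multiples[of p "insert p P" y] p by simp
  finally show ?thesis .
qed

text \<open>For squarefree \<open>q\<close> the value \<open>1/\<phi>(q)\<close> is the sum of \<open>1/n\<close> over all \<open>n\<close> with the same prime factors as \<open>q\<close>. The induction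
adds one prime \<open>p\<close> at a time. It uses the recursions for both sums, and the geometric
series over the powers of \<open>p\<close> is replaced by the inequality \<open>A \<le> recip_sum P (y div p) + A/p\<close> for
\<open>A = recip_sum (insert p P) (y div p)\<close>.\<close>

lemma recip_sum_le_totient_sum:
  assumes "finite P" "\<And>p. p \<in> P \<Longrightarrow> prime p"
  shows "recip_sum P y \<le> totient_sum P y"
  using assms
proof (induction P arbitrary: y rule: finite_induct)
  case empty
  have "numbers_over {} y = (if y = 0 then {} else {1})"
  proof (intro equalityI subsetI)
    fix n assume n: "n \<in> numbers_over {} y"
    then have "n = 1" by (auto simp: numbers_over_def prime_factorization_empty_iff)
    then show "n \<in> (if y = 0 then {} else {1})" using n by (auto simp: numbers_over_def)
  qed (auto simp: numbers_over_def split: if_splits)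
  moreover from this have "sqfree_over {} y = (if y = 0 then {} else {1})"
    unfolding sqfree_over_def by (auto simp del: One_nat_def)
  ultimately show ?case by (simp add: recip_sum_def totient_sum_def)
next
  case (insert p P)
  then have p: "prime p" "p \<notin> P" by auto
  have p1: "real p > 1" "real (p - 1) = real p - 1" using prime_gt_1_nat[OF p(1)] by (auto simp: of_nat_diff)
  define A where "A = recip_sum (insert p P) (y div p)"
  have "recip_sum (insert p P) (y div p div p) \<le> A"
    unfolding A_def by (intro recip_sum_mono) auto
  then have "A \<le> recip_sum P (y div p) + A / real p"
    using recip_sum_insert[OF p, of "y div p"] p1 by (simp add: A_def[symmetric] divide_right_mono)
  then have "A / real p \<le> recip_sum P (y div p) / real (p - 1)"
    using p1 by (simp add: field_simps)
  also have "\<dots> \<le> totient_sum P (y div p) / real (p - 1)"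
    using insert by (intro divide_right_mono) auto
  finally show ?case
    using recip_sum_insert[OF p, of y] totient_sum_insert[OF p, of y] insert
    by (simp add: A_def add_mono)
qed

text \<open>Every number over \<open>P \<union> R\<close> is a product of a number over \<open>P\<close> and a number over \<open>R\<close>.\<close>

lemma recip_sum_Un_le: "recip_sum (P \<union> R) y \<le> recip_sum P y * recip_sum R y"
proof -
  have split: "\<exists>a b. n = a * b \<and> a \<in> numbers_over P n \<and> b \<in> numbers_over R n"
    if "n > 0" "prime_factors n \<subseteq> P \<union> R" for n
    using that
  proof (induction n rule: less_induct)
    case (less n)
    show ?case
    proof (cases "n = 1")
      case False
      then obtain p where p: "prime p" "p dvd n" using prime_factor_nat by blast
      then obtain m where m: "n = p * m" by auto
      have m0: "m > 0" "m < n" using less.prems m prime_gt_1_nat[OF p(1)] by auto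
      have pf: "prime_factors n = insert p (prime_factors m)"
        using prime_factors_prime_mult[OF p(1) m0(1)] m by simp
      obtain a b where ab: "m = a * b" "a \<in> numbers_over P m" "b \<in> numbers_over R m"
        using less.IH[OF m0(2,1)] less.prems pf by auto
      have div: "n div p = m" using m prime_gt_0_nat[OF p(1)] by simp
      show ?thesis
      proof (cases "p \<in> P")
        case True
        then have "p * a \<in> numbers_over P n" using ab p(1) by (simp add: mem_numbers_over_mult div)
        moreover have "b \<in> numbers_over R n" using ab m0 numbers_over_mono[of R R m n] by auto
        ultimately show ?thesis using m ab by (metis mult.assoc)
      next
        case False
        then have "p \<in> R" using pf less.prems by auto
        then have "p * b \<in> numbers_over R n" using ab p(1) by (simp add: mem_numbers_over_mult div)
        moreover have "a \<in> numbers_over P n" using ab m0 numbers_over_mono[of P P m n] by auto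
        ultimately show ?thesis using m ab by (metis mult.left_commute)
      qed
    qed (auto simp: numbers_over_def intro!: exI[of _ "1::nat"])
  qed
  have "numbers_over (P \<union> R) y \<subseteq> (\<lambda>(a, b). a * b) ` (numbers_over P y \<times> numbers_over R y)"
  proof
    fix n assume n: "n \<in> numbers_over (P \<union> R) y"
    then obtain a b where "n = a * b" "a \<in> numbers_over P n" "b \<in> numbers_over R n"
      using split[of n] by (auto simp: numbers_over_def)
    moreover have "n \<le> y" using n by (simp add: numbers_over_def)
    ultimately show "n \<in> (\<lambda>(a, b). a * b) ` (numbers_over P y \<times> numbers_over R y)"
      using numbers_over_mono[of P P n y] numbers_over_mono[of R R n y] by auto
  qed
  then have "recip_sum (P \<union> R) y
    \<le> (\<Sum>n\<in>(\<lambda>(a, b). a * b) ` (numbers_over P y \<times> numbers_over R y). 1 / real n)"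
    unfolding recip_sum_def by (intro sum_mono2) auto
  also have "\<dots> \<le> (\<Sum>(a, b)\<in>numbers_over P y \<times> numbers_over R y. 1 / real (a * b))"
    by (rule order.trans[OF sum_image_le]) (auto simp: o_def split_def)
  also have "\<dots> = recip_sum P y * recip_sum R y"
    by (simp add: recip_sum_def sum_product sum.cartesian_product)
  finally show ?thesis .
qed

lemma ln_le_recip_sum:
  assumes "\<And>p. prime p \<Longrightarrow> p \<le> y \<Longrightarrow> p \<in> P"
  shows "ln (real y + 1) \<le> recip_sum P y"
proof -
  have "numbers_over P y = {1..y}"
  proof (intro equalityI subsetI)
    fix n assume n: "n \<in> {1..y}"
    have "p \<in> P" if "prime p" "p dvd n" for p
      using assms[of p] dvd_imp_le[of p n] that n by auto
    then show "n \<in> numbers_over P y" using n by (auto simp: numbers_over_def)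
  qed (auto simp: numbers_over_def)
  then have "recip_sum P y = harm y" by (simp add: recip_sum_def harm_def inverse_eq_divide)
  then show ?thesis using ln_le_harm[of y] by simp
qed

section \<open>An upper bound of Mertens type\<close>

lemma ln_eq_sum_multiplicity:
  assumes "m > 0" "finite P" "\<And>p. p \<in> P \<Longrightarrow> prime p" "prime_factors m \<subseteq> P"
  shows "ln (real m) = (\<Sum>p\<in>P. real (multiplicity p m) * ln (real p))"
proof -
  have pos: "real p > 0" if "p \<in> P" for p
    using that assms(3) prime_gt_0_nat by auto
  have "real m = real (\<Prod>p\<in>prime_factors m. p ^ multiplicity p m)"
    using assms(1) prime_factorization_nat[of m] by simp
  also have "(\<Prod>p\<in>prime_factors m. p ^ multiplicity p m) = (\<Prod>p\<in>P. p ^ multiplicity p m)"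
    using assms by (intro prod.mono_neutral_left) (auto simp: in_prime_factors_iff not_dvd_imp_multiplicity_0)
  finally have "ln (real m) = (\<Sum>p\<in>P. ln (real p ^ multiplicity p m))"
    using pos by (simp add: ln_prod[OF assms(2)])
  then show ?thesis using pos by (simp add: ln_realpow)
qed

text \<open>In \<open>z ln z \<ge> ln (z!)\<close> the prime \<open>p\<close> contributes at least \<open>\<lfloor>z/p\<rfloor> ln p\<close> to the right-hand side, and
\<open>\<lfloor>z/p\<rfloor> \<ge> z/(2p)\<close> for \<open>p \<le> z\<close>.\<close>

lemma sum_ln_prime_over_prime_le:
  assumes "z > 0"
  shows "(\<Sum>p | prime p \<and> p \<le> z. ln (real p) / real p) \<le> 2 * ln (real z)"
proof -
  define P where "P = {p. prime p \<and> p \<le> z}"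
  have P: "finite P" "\<And>p. p \<in> P \<Longrightarrow> prime p" by (auto simp: P_def)
  have lnp: "0 \<le> ln (real p)" if "p \<in> P" for p
    using prime_ge_1_nat[OF P(2)[OF that]] by simp
  have "(\<Sum>p\<in>P. real z / (2 * real p) * ln (real p))
    \<le> (\<Sum>p\<in>P. \<Sum>m=1..z. real (multiplicity p m) * ln (real p))"
  proof (rule sum_mono)
    fix p assume p: "p \<in> P"
    then have pp: "prime p" "0 < p" "p \<le> z" using prime_gt_0_nat by (auto simp: P_def)
    have mult: "1 \<le> real (multiplicity p (p * m))" if "m > 0" for m
      using multiplicity_times_same[of m p] pp that prime_gt_1_nat[of p] by simp
    have k1: "1 \<le> z div p" using pp by (simp add: Suc_le_eq div_greater_zero_iff)
    have "z < (z div p + 1) * p" using pp by (simp add: dividend_less_div_times)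
    then have "real z < (real (z div p) + 1) * real p"
      by (metis of_nat_1 of_nat_add of_nat_less_iff of_nat_mult)
    also have "\<dots> \<le> (2 * real (z div p)) * real p"
      using k1 by (intro mult_right_mono) auto
    finally have "real z / (2 * real p) \<le> real (z div p)"
      using pp by (simp add: divide_le_eq mult_ac)
    also have "\<dots> = (\<Sum>m\<in>{1..z div p}. 1)" by simp
    also have "\<dots> \<le> (\<Sum>m\<in>{1..z div p}. real (multiplicity p (p * m)))"
      using mult by (intro sum_mono) auto
    also have "\<dots> = (\<Sum>m\<in>(*) p ` {1..z div p}. real (multiplicity p m))"
      using pp by (subst sum.reindex) (auto intro: inj_onI)
    also have "\<dots> \<le> (\<Sum>m=1..z. real (multiplicity p m))"
      using pp by (intro sum_mono2) (auto simp: less_eq_div_iff_mult_less_eq mult.commute)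
    finally show "real z / (2 * real p) * ln (real p) \<le> (\<Sum>m=1..z. real (multiplicity p m) * ln (real p))"
      unfolding sum_distrib_right[symmetric] by (rule mult_right_mono) (rule lnp[OF p])
  qed
  also have "\<dots> = (\<Sum>m=1..z. \<Sum>p\<in>P. real (multiplicity p m) * ln (real p))"
    by (rule sum.swap)
  also have "\<dots> = (\<Sum>m=1..z. ln (real m))"
  proof (intro sum.cong refl)
    fix m assume m: "m \<in> {1..z}"
    have "prime_factors m \<subseteq> P"
    proof
      fix p assume "p \<in> prime_factors m"
      then show "p \<in> P" using m dvd_imp_le[of p m] by (auto simp: P_def in_prime_factors_iff)
    qed
    then show "(\<Sum>p\<in>P. real (multiplicity p m) * ln (real p)) = ln (real m)"
      using m P by (intro ln_eq_sum_multiplicity[symmetric]) auto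
  qed
  also have "\<dots> \<le> (\<Sum>m=1..z. ln (real z))"
    by (intro sum_mono) auto
  finally have "real z / 2 * (\<Sum>p\<in>P. ln (real p) / real p) \<le> real z * ln (real z)"
    by (simp add: sum_distrib_left mult_ac)
  then show ?thesis using assms by (simp add: P_def)
qed

text \<open>Writing the multiples of \<open>p\<close> as \<open>p m\<close> shows that the sum \<open>A\<close> on the left satisfies
\<open>A \<le> (recip_sum P y + A)/p\<close>.\<close>

lemma sum_multiplicity_recip_le:
  assumes p: "prime p" "p \<in> P"
  shows "(\<Sum>m\<in>numbers_over P y. real (multiplicity p m) / real m) \<le> recip_sum P y / (real p - 1)"
proof -
  define A where "A = (\<Sum>m\<in>numbers_over P y. real (multiplicity p m) / real m)"
  have p1: "real p > 1" using prime_gt_1_nat[OF p(1)] by auto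
  have inj: "inj_on ((*) p) B" for B using prime_gt_0_nat[OF p(1)] by (auto intro: inj_onI)
  have "A = (\<Sum>m\<in>(*) p ` numbers_over P (y div p). real (multiplicity p m) / real m)"
    unfolding A_def
  proof (rule sum.mono_neutral_right)
    show "\<forall>m\<in>numbers_over P y - (*) p ` numbers_over P (y div p). real (multiplicity p m) / real m = 0"
    proof
      fix m assume m: "m \<in> numbers_over P y - (*) p ` numbers_over P (y div p)"
      have "\<not> p dvd m"
      proof
        assume "p dvd m"
        then obtain k where "m = p * k" by auto
        then show False using m mem_numbers_over_mult[OF p] by auto
      qed
      then show "real (multiplicity p m) / real m = 0" by (simp add: not_dvd_imp_multiplicity_0)
    qed
  qed (use mem_numbers_over_mult[OF p] in auto)
  also have "\<dots> = (\<Sum>m\<in>numbers_over P (y div p). real (multiplicity p (p * m)) / real (p * m))"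
    by (simp add: sum.reindex[OF inj])
  also have "\<dots> = (\<Sum>m\<in>numbers_over P (y div p). (1 / real m + real (multiplicity p m) / real m) / real p)"
  proof (intro sum.cong refl)
    fix m assume "m \<in> numbers_over P (y div p)"
    then have "m > 0" by (rule numbers_over_pos)
    then have "multiplicity p (p * m) = Suc (multiplicity p m)"
      using p(1) by (intro multiplicity_times_same) auto
    then show "real (multiplicity p (p * m)) / real (p * m) = (1 / real m + real (multiplicity p m) / real m) / real p"
      by (simp add: add_divide_distrib mult.commute)
  qed
  also have "\<dots> \<le> (\<Sum>m\<in>numbers_over P y. (1 / real m + real (multiplicity p m) / real m) / real p)"
    by (intro sum_mono2 numbers_over_mono) auto
  also have "\<dots> = (recip_sum P y + A) / real p"
    by (simp add: A_def recip_sum_def sum.distrib flip: sum_divide_distrib)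
  finally have "A \<le> recip_sum P y / (real p - 1)"
    using p1 by (simp add: field_simps)
  then show ?thesis by (simp add: A_def)
qed

text \<open>Give \<open>m\<close> the weight \<open>1/m\<close>. The weighted mean of \<open>ln m\<close> over numbers without prime factors above \<open>z\<close> is at
most \<open>\<Sum>ln p/(p - 1) \<le> 4 ln z\<close>. By Markov's inequality at least half of the weight lies on \<open>m \<le> z\<^sup>8\<close>,
where it is at most the harmonic sum \<open>1 + 8 ln z\<close>.\<close>

lemma smooth_recip_sum_le:
  assumes z: "z \<ge> 2"
  shows "recip_sum {p. prime p \<and> p \<le> z} y \<le> 2 + 16 * ln (real z)"
proof -
  define P where "P = {p. prime p \<and> p \<le> z}"
  define F where "F = recip_sum P y"
  define B where "B = numbers_over P y"
  have P: "finite P" "\<And>p. p \<in> P \<Longrightarrow> prime p" by (auto simp: P_def)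
  have L: "ln (real z) > 0" using z by simp
  have F0: "F \<ge> 0" by (simp add: F_def recip_sum_nonneg)
  have "(\<Sum>m\<in>B. ln (real m) / real m) = (\<Sum>m\<in>B. \<Sum>p\<in>P. ln (real p) * (real (multiplicity p m) / real m))"
  proof (intro sum.cong refl)
    fix m assume "m \<in> B"
    then have "ln (real m) = (\<Sum>p\<in>P. real (multiplicity p m) * ln (real p))"
      using P by (intro ln_eq_sum_multiplicity) (auto simp: B_def numbers_over_def)
    then show "ln (real m) / real m = (\<Sum>p\<in>P. ln (real p) * (real (multiplicity p m) / real m))"
      by (simp add: sum_divide_distrib mult_ac)
  qed
  also have "\<dots> = (\<Sum>p\<in>P. ln (real p) * (\<Sum>m\<in>B. real (multiplicity p m) / real m))"
    by (subst sum.swap) (simp add: sum_distrib_left)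
  also have "\<dots> \<le> (\<Sum>p\<in>P. ln (real p) * (F * (2 / real p)))"
  proof (intro sum_mono mult_left_mono)
    fix p assume p: "p \<in> P"
    have p2: "real p \<ge> 2" using prime_ge_2_nat[OF P(2)[OF p]] by simp
    have "(\<Sum>m\<in>B. real (multiplicity p m) / real m) \<le> F * (1 / (real p - 1))"
      using sum_multiplicity_recip_le[OF P(2)[OF p] p, of y] by (simp add: B_def F_def)
    also have "\<dots> \<le> F * (2 / real p)"
      using F0 p2 by (intro mult_left_mono) (auto simp: field_simps)
    finally show "(\<Sum>m\<in>B. real (multiplicity p m) / real m) \<le> F * (2 / real p)" .
    show "0 \<le> ln (real p)" using p2 by simp
  qed
  also have "\<dots> = 2 * F * (\<Sum>p\<in>P. ln (real p) / real p)"
    by (simp add: sum_distrib_left mult_ac)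
  also have "\<dots> \<le> 2 * F * (2 * ln (real z))"
    using F0 sum_ln_prime_over_prime_le[of z] z by (intro mult_left_mono) (auto simp: P_def)
  finally have mean: "(\<Sum>m\<in>B. ln (real m) / real m) \<le> 4 * ln (real z) * F" by (simp add: mult_ac)
  have "F = (\<Sum>m\<in>{m\<in>B. m \<le> z ^ 8}. 1 / real m) + (\<Sum>m\<in>{m\<in>B. z ^ 8 < m}. 1 / real m)"
    unfolding F_def recip_sum_def B_def[symmetric]
    by (subst sum.union_disjoint[symmetric]) (auto simp: B_def intro!: sum.cong)
  also have "(\<Sum>m\<in>{m\<in>B. m \<le> z ^ 8}. 1 / real m) \<le> (\<Sum>m=1..z^8. 1 / real m)"
    by (intro sum_mono2) (auto simp: B_def numbers_over_def)
  also have "\<dots> = harm (z ^ 8)" by (simp add: harm_def inverse_eq_divide)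
  also have "\<dots> \<le> 1 + ln (real (z ^ 8))"
    using euler_mascheroni_sequence_decreasing[of 1 "z ^ 8"] z by (simp add: harm_def)
  also have "\<dots> = 1 + 8 * ln (real z)" using z by (simp add: ln_realpow)
  also have "(\<Sum>m\<in>{m\<in>B. z ^ 8 < m}. 1 / real m) \<le> (\<Sum>m\<in>{m\<in>B. z ^ 8 < m}. ln (real m) / real m / (8 * ln (real z)))"
  proof (intro sum_mono)
    fix m assume m: "m \<in> {m\<in>B. z ^ 8 < m}"
    then have "real (z ^ 8) < real m" by (subst of_nat_less_iff) simp
    moreover have "0 < real (z ^ 8)" using z by simp
    ultimately have "ln (real (z ^ 8)) \<le> ln (real m)" by (intro ln_mono) auto
    then have "8 * ln (real z) \<le> ln (real m)" using z by (simp add: ln_realpow)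
    then have "1 \<le> ln (real m) / (8 * ln (real z))" using L by simp
    then have "1 / real m \<le> ln (real m) / (8 * ln (real z)) / real m" by (intro divide_right_mono) auto
    then show "1 / real m \<le> ln (real m) / real m / (8 * ln (real z))" by (simp add: mult.commute)
  qed
  also have "\<dots> \<le> (\<Sum>m\<in>B. ln (real m) / real m / (8 * ln (real z)))"
    using L by (intro sum_mono2) (auto simp: B_def dest: numbers_over_pos)
  also have "\<dots> \<le> (4 * ln (real z) * F) / (8 * ln (real z))"
    unfolding sum_divide_distrib[symmetric] using mean L by (intro divide_right_mono) auto
  also have "\<dots> = F / 2" using L by simp
  finally show ?thesis by (simp add: F_def P_def)
qed

text \<open>The harmonic sum up to \<open>y\<close>, at least \<open>ln (y + 1)\<close>, is at most the product of its part without prime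
factors above \<open>z\<close> and its part with only such prime factors.\<close>

lemma rough_totient_sum_ge:
  assumes z: "z \<ge> 2"
  shows "ln (real y + 1) \<le> (2 + 16 * ln (real z)) * totient_sum {p. prime p \<and> z < p \<and> p \<le> y} y"
proof -
  let ?S = "{p. prime p \<and> p \<le> z}" and ?R = "{p. prime p \<and> z < p \<and> p \<le> y}"
  have "ln (real y + 1) \<le> recip_sum (?S \<union> ?R) y"
    by (rule ln_le_recip_sum) auto
  also have "\<dots> \<le> recip_sum ?S y * recip_sum ?R y"
    by (rule recip_sum_Un_le)
  also have "\<dots> \<le> (2 + 16 * ln (real z)) * totient_sum ?R y"
    using z by (intro mult_mono smooth_recip_sum_le recip_sum_le_totient_sum recip_sum_nonneg) auto
  finally show ?thesis .
qed

section \<open>Spacing of fractions and the Brun-Titchmarsh inequality\<close>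

lemma totative_fractions_distinct:
  assumes a: "a \<in> totatives q" and a': "a' \<in> totatives q'"
    and eq: "int a * int q' - int a' * int q = k * int q * int q'"
  shows "q = q' \<and> a = a'"
proof -
  have q: "q > 0" "q' > 0" using a a' by (auto intro!: Nat.gr0I)
  have cop: "coprime (int a) (int q)" "coprime (int a') (int q')"
    using a a' by (simp_all add: in_totatives_iff)
  have "int a * int q' = int q * (int a' + k * int q')" using eq by (simp add: algebra_simps)
  then have "int q dvd int a * int q'" by (metis dvd_triv_left)
  then have "int q dvd int q'" using cop by (simp add: coprime_dvd_mult_right_iff coprime_commute)
  moreover have "int a' * int q = int q' * (int a - k * int q)" using eq by (simp add: algebra_simps)
  then have "int q' dvd int a' * int q" by (metis dvd_triv_left)
  then have "int q' dvd int q" using cop by (simp add: coprime_dvd_mult_right_iff coprime_commute)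
  ultimately have qq: "q = q'" by (simp add: dvd_antisym)
  have "(int a - int a') * int q = (k * int q) * int q" using eq qq by (simp add: algebra_simps)
  then have k: "int a - int a' = k * int q" using q by simp
  have "\<bar>int a - int a'\<bar> < int q" using a a' qq by (auto simp: in_totatives_iff)
  then have "\<bar>k\<bar> * int q < 1 * int q" using k by (simp add: abs_mult)
  then have "k = 0" using q by (simp del: mult_1)
  then show ?thesis using k qq by simp
qed

lemma fraction_diff_eq:
  assumes "q > 0" "q' > 0"
  shows "real a / real q - real a' / real q' - real_of_int k
    = real_of_int (int a * int q' - int a' * int q - k * int q * int q') / real (q * q')"
  using assms by (simp add: field_simps)

lemma totative_fractions_spaced:
  assumes a: "a \<in> totatives q" and a': "a' \<in> totatives q'"
    and Q: "q \<le> Q" "q' \<le> Q" and ne: "(q, a) \<noteq> (q', a')"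
  shows "1 / real (Q ^ 2) \<le> dist_Z (real a / real q - real a' / real q')"
proof -
  have q: "q > 0" "q' > 0" using a a' by (auto intro!: Nat.gr0I)
  obtain k where k: "dist_Z (real a / real q - real a' / real q') = \<bar>real a / real q - real a' / real q' - real_of_int k\<bar>"
    by (rule dist_Z_attained)
  define c where "c = int a * int q' - int a' * int q - k * int q * int q'"
  have "c \<noteq> 0" using totative_fractions_distinct[OF a a', of k] ne by (auto simp: c_def)
  then have "1 \<le> \<bar>real_of_int c\<bar>" by linarith
  have "1 / real (Q ^ 2) \<le> 1 / real (q * q')"
    using q Q by (intro divide_left_mono of_nat_mono) (simp_all add: power2_eq_square mult_le_mono)
  also have "\<dots> \<le> \<bar>real_of_int c\<bar> / real (q * q')"
    using \<open>1 \<le> \<bar>real_of_int c\<bar>\<close> by (intro divide_right_mono) auto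
  also have "\<dots> = dist_Z (real a / real q - real a' / real q')"
    unfolding k fraction_diff_eq[OF q] c_def by (simp add: abs_divide)
  finally show ?thesis .
qed

lemma primes_between_interval:
  assumes "M \<ge> 0" "N \<ge> 0"
  obtains m n where "primes_between (M + 1) (M + N) \<subseteq> {m..<m + n}" "real n \<le> N"
proof
  define m where "m = nat \<lceil>M + 1\<rceil>"
  define n where "n = nat (\<lfloor>M + N\<rfloor> + 1 - \<lceil>M + 1\<rceil>)"
  show "primes_between (M + 1) (M + N) \<subseteq> {m..<m + n}"
  proof
    fix p assume "p \<in> primes_between (M + 1) (M + N)"
    then have p: "M + 1 \<le> real p" "real p \<le> M + N" by (auto simp: primes_between_def)
    then have "\<lceil>M + 1\<rceil> \<le> int p" "int p \<le> \<lfloor>M + N\<rfloor>" by linarith+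
    moreover have "0 \<le> \<lceil>M + 1\<rceil>" using assms by linarith
    ultimately show "p \<in> {m..<m + n}" by (auto simp: m_def n_def)
  qed
  show "real n \<le> N" using assms unfolding n_def by linarith
qed

lemma finite_primes_between: "M \<ge> 0 \<Longrightarrow> N \<ge> 0 \<Longrightarrow> finite (primes_between (M + 1) (M + N))"
  using primes_between_interval[of M N] finite_subset[OF _ finite_atLeastLessThan] by metis

lemma coprime_large_prime:
  fixes p :: nat
  assumes "prime p" "0 < q" "q < p"
  shows "coprime p q"
  using assms by (meson dvd_imp_le not_le prime_imp_coprime)

lemma ln_1000_ge: "ln (1000::real) \<ge> 68 / 10"
proof -
  \<comment> \<open>\<open>6.8 = 34/5\<close>, and \<open>2.72\<^bsup>34\<^esup>\<close> is below \<open>10\<^bsup>15\<^esup>\<close>.\<close>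
  have "exp (34::real) = exp 1 ^ 34" by (simp flip: exp_of_nat_mult)
  also have "\<dots> \<le> (272 / 100) ^ 34" using e_less_272 by (intro power_mono) auto
  also have "\<dots> \<le> (1000::real) ^ 5" by (simp add: power_divide divide_le_eq)
  finally have "ln (exp (34::real)) \<le> ln ((1000::real) ^ 5)" by (subst ln_le_cancel_iff) auto
  also have "\<dots> = 5 * ln 1000" by (subst ln_realpow) auto
  finally show ?thesis by simp
qed

text \<open>With \<open>L = ln N \<ge> 6.8\<close> the main term is at most \<open>3.9 N / L\<close>, because \<open>9/8 L \<le> 3.9 (L/2 - ln 4)\<close>, and
\<open>sqrt N / 4\<close> is at most \<open>0.1 N / L\<close>.\<close>

lemma brun_titchmarsh_numeric:
  fixes N :: real
  assumes "N \<ge> 1000"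
  shows "0 < ln (sqrt N / 4)" "sqrt N / 4 + (9 / 8 * N) / ln (sqrt N / 4) \<le> 4 * N / ln N"
proof -
  define s where "s = sqrt N"
  define L where "L = ln N"
  have "s \<ge> 31" unfolding s_def using assms by (intro real_le_rsqrt) simp
  then have s: "s \<ge> 31" "s * s = N" using assms by (simp_all add: s_def)
  have L: "L \<ge> 68 / 10" using ln_1000_ge assms ln_mono[of 1000 N] unfolding L_def by linarith
  have ln4: "ln (4::real) \<le> 14 / 10"
    using ln_realpow[of "2::real" 2] ln2_le_25_over_36 by simp
  have D: "ln (sqrt N / 4) = L / 2 - ln 4" using assms by (simp add: ln_div ln_sqrt L_def)
  then have D2: "ln (sqrt N / 4) \<ge> L / 2 - 14 / 10" using ln4 by simp
  then show D0: "0 < ln (sqrt N / 4)" using L by linarith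
  have "9 / 8 * L \<le> (39 / 10) * ln (sqrt N / 4)" using D2 L by linarith
  then have "9 / 8 / ln (sqrt N / 4) \<le> (39 / 10) / L"
    using D0 L by (simp add: field_simps)
  then have "N * (9 / 8 / ln (sqrt N / 4)) \<le> N * ((39 / 10) / L)"
    using assms by (intro mult_left_mono) auto
  moreover have "s / 4 \<le> N * ((1 / 10) / L)"
  proof -
    have "ln (16::real) \<le> 28 / 10" using ln_realpow[of "2::real" 4] ln2_le_25_over_36 by simp
    moreover have "ln (s / 16) \<le> s / 16 - 1" using s by (intro ln_le_minus_one) auto
    moreover have "L = 2 * ln s" using s ln_mult[of s s] by (simp add: L_def)
    moreover have "ln s = ln (s / 16) + ln 16" using s by (simp add: ln_div)
    ultimately have "L \<le> 4 / 10 * s" using s by linarith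
    then have "s * L \<le> s * (4 / 10 * s)" using s by (intro mult_left_mono) auto
    also have "\<dots> = 4 / 10 * N" using s by simp
    finally show ?thesis using L by (simp add: field_simps)
  qed
  ultimately show "sqrt N / 4 + (9 / 8 * N) / ln (sqrt N / 4) \<le> 4 * N / ln N"
    using L by (simp add: s_def[symmetric] L_def[symmetric] add_divide_distrib[symmetric] field_simps)
qed

text \<open>The sifted large sieve at the single point 0, with all squarefree moduli up to \<open>Q = \<lfloor>sqrt N / 4\<rfloor>\<close> and all
coefficients 1, bounds the number of primes exceeding \<open>Q\<close>. The fractions \<open>a/q\<close> are spaced by \<open>1/Q\<^sup>2\<close>, and
\<open>2 Q\<^sup>2 \<le> N/8\<close>.\<close>

theorem brun_titchmarsh:
  assumes N: "N \<ge> 1000" and M: "M \<ge> 0"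
  shows "real (card (primes_between (M + 1) (M + N))) \<le> 4 * N / ln N"
proof -
  define A where "A = primes_between (M + 1) (M + N)"
  obtain m n where mn: "A \<subseteq> {m..<m + n}" "real n \<le> N"
    using primes_between_interval[of M N] N M unfolding A_def by auto
  have finA: "finite A" using mn finite_subset by blast
  define Q where "Q = nat \<lfloor>sqrt N / 4\<rfloor>"
  have s31: "sqrt N \<ge> 31" using N by (intro real_le_rsqrt) auto
  then have Q: "real Q \<le> sqrt N / 4" "sqrt N / 4 < real Q + 1" "Q \<ge> 1"
    unfolding Q_def by linarith+
  define S where "S = {p \<in> A. Q < p}"
  have "A \<subseteq> S \<union> {1..Q}" by (auto simp: S_def A_def primes_between_def dest: prime_ge_1_nat)
  then have "card A \<le> card (S \<union> {1..Q})" using finA by (intro card_mono) (auto simp: S_def)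
  also have "\<dots> \<le> card S + Q" using card_Un_le[of S "{1..Q}"] by simp
  finally have cA: "real (card A) \<le> real (card S) + real Q" by simp
  define P where "P = {p. prime p \<and> p \<le> Q}"
  define G where "G = totient_sum P Q"
  have G: "ln (sqrt N / 4) \<le> G"
  proof -
    have "ln (sqrt N / 4) \<le> ln (real Q + 1)" using Q s31 by (intro ln_mono) linarith+
    also have "\<dots> \<le> recip_sum P Q" by (rule ln_le_recip_sum) (auto simp: P_def)
    also have "\<dots> \<le> G" unfolding G_def by (rule recip_sum_le_totient_sum) (auto simp: P_def)
    finally show ?thesis .
  qed
  have lpos: "0 < ln (sqrt N / 4)" using brun_titchmarsh_numeric(1)[OF N] .
  have G0: "0 < G" using G lpos by linarith
  have "(\<Sum>x\<in>{0}. (\<Sum>q\<in>sqfree_over P Q. 1 / real (totient q)) * (norm (exp_sum S (\<lambda>_. 1) x))\<^sup>2)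
    \<le> (real n + 2 / (1 / real (Q ^ 2))) * (\<Sum>n\<in>S. (norm (1::complex))\<^sup>2)"
  proof (rule sifted_large_sieve)
    show "S \<subseteq> {m..<m + n}" using mn by (auto simp: S_def)
    show "0 < 1 / real (Q ^ 2)" using Q by simp
    fix x :: real and q assume q: "q \<in> sqfree_over P Q"
    then show "squarefree q" by (simp add: sqfree_over_def)
    fix n assume "n \<in> S"
    then show "coprime n q"
      using q by (intro coprime_large_prime) (auto simp: S_def A_def primes_between_def sqfree_over_def numbers_over_def)
  next
    fix x x' :: real and q a q' a' :: nat
    assume *: "x \<in> {0}" "q \<in> sqfree_over P Q" "a \<in> totatives q" "x' \<in> {0}"
      "q' \<in> sqfree_over P Q" "a' \<in> totatives q'" "(x, q, a) \<noteq> (x', q', a')"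
    then show "1 / real (Q ^ 2) \<le> dist_Z ((x + real a / real q) - (x' + real a' / real q'))"
      using totative_fractions_spaced[of a q a' q' Q] by (simp add: sqfree_over_def numbers_over_def)
  qed auto
  then have "G * (real (card S))\<^sup>2 \<le> (real n + 2 * real (Q ^ 2)) * real (card S)"
    by (simp add: exp_sum_def G_def totient_sum_def)
  also have "\<dots> \<le> (9 / 8 * N) * real (card S)"
  proof (rule mult_right_mono)
    have "(real Q)\<^sup>2 \<le> (sqrt N / 4)\<^sup>2" using Q by (intro power_mono) auto
    then show "real n + 2 * real (Q ^ 2) \<le> 9 / 8 * N" using mn N by (simp add: power_divide)
  qed simp
  finally have "(G * real (card S)) * real (card S) \<le> (9 / 8 * N) * real (card S)"
    by (simp add: power2_eq_square mult.assoc)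
  then have "G * real (card S) \<le> 9 / 8 * N"
    using N by (cases "card S = 0") auto
  then have "real (card S) \<le> (9 / 8 * N) / G"
    using G0 by (subst pos_le_divide_eq) (auto simp: mult_ac)
  also have "\<dots> \<le> (9 / 8 * N) / ln (sqrt N / 4)"
    using G G0 lpos N by (intro divide_left_mono mult_pos_pos) linarith+
  finally have "real (card A) \<le> sqrt N / 4 + (9 / 8 * N) / ln (sqrt N / 4)"
    using cA Q by linarith
  then show ?thesis using brun_titchmarsh_numeric(2)[OF N] unfolding A_def by linarith
qed

section \<open>The large sieve for few points and rough moduli\<close>

text \<open>Two different fractions with denominators at most \<open>D\<close> differ by at least \<open>1/D\<^sup>2\<close>, so at most one of them,
as a rational number, lies within \<open>\<eta>\<close> of \<open>- \<theta>\<close>. If it is not an integer, take any prime factor of its reduced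
denominator: it divides the denominator of every representation \<open>c/d\<close>. If there is no
such fraction, any prime above \<open>z\<close> will do.\<close>

lemma separating_prime:
  fixes \<theta> \<eta> :: real and D z :: nat
  assumes \<eta>: "2 * \<eta> \<le> 1 / real (D ^ 2)"
  obtains P where "prime P" "z < P"
    "\<And>c d. 0 < d \<Longrightarrow> d \<le> D \<Longrightarrow> (\<And>p. prime p \<Longrightarrow> p dvd d \<Longrightarrow> z < p) \<Longrightarrow> \<not> int d dvd c \<Longrightarrow>
      \<bar>\<theta> + real_of_int c / real d\<bar> < \<eta> \<Longrightarrow> P dvd d"
proof -
  define near where "near c d \<longleftrightarrow> 0 < d \<and> d \<le> D \<and> (\<forall>p. prime p \<longrightarrow> p dvd d \<longrightarrow> z < p) \<and>
    \<not> int d dvd c \<and> \<bar>\<theta> + real_of_int c / real d\<bar> < \<eta>" for c :: int and d :: nat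
  show ?thesis
  proof (cases "\<exists>c d. near c d")
    case False
    obtain P where "prime P" "z < P" using bigger_prime by blast
    with False show ?thesis by (intro that[of P]) (auto simp: near_def)
  next
    case True
    then obtain c0 d0 where n0: "near c0 d0" by blast
    define g where "g = gcd c0 (int d0)"
    have d0: "d0 > 0" "d0 \<le> D" "\<not> int d0 dvd c0" using n0 by (auto simp: near_def)
    have g: "g > 0" using d0 by (simp add: g_def)
    have "gcd c0 (int d0) \<noteq> 0" using g unfolding g_def by simp
    from gcd_coprime_exists[OF this]
    obtain c1 r where cr: "c0 = c1 * g" "int d0 = r * g" "coprime c1 r"
      unfolding g_def by blast
    have r0: "r > 0" using cr d0 g by (metis of_nat_0_less_iff zero_less_mult_pos2)
    have "r \<noteq> 1" using cr d0 by auto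
    then have "nat r \<noteq> 1" using r0 by linarith
    then obtain P where P: "prime P" "P dvd nat r" using prime_factor_nat[of "nat r"] by blast
    have rP: "int P dvd r" using P r0 by (metis int_dvd_int_iff nat_0_le order_less_imp_le)
    then have "int P dvd int d0" using cr by simp
    then have "P dvd d0" by simp
    then have zP: "z < P" using n0 P by (auto simp: near_def)
    have "P dvd d" if n: "near c d" for c d
    proof -
      have d: "d > 0" "d \<le> D" using n by (auto simp: near_def)
      have "\<bar>real_of_int c / real d - real_of_int c0 / real d0\<bar> < 2 * \<eta>"
        using n n0 unfolding near_def by linarith
      also have "\<dots> \<le> 1 / real (D ^ 2)" by (rule \<eta>)
      also have "\<dots> \<le> 1 / real (d * d0)"
        using d d0 by (intro divide_left_mono of_nat_mono) (simp_all add: power2_eq_square mult_le_mono)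
      also have "real_of_int c / real d - real_of_int c0 / real d0
        = real_of_int (c * int d0 - c0 * int d) / real (d * d0)"
        using d d0 by (simp add: field_simps)
      finally have "\<bar>real_of_int (c * int d0 - c0 * int d)\<bar> / real (d * d0) < 1 / real (d * d0)"
        by (simp add: abs_divide)
      then have "\<bar>real_of_int (c * int d0 - c0 * int d)\<bar> < 1"
        using d d0 by (simp add: divide_less_cancel del: of_int_diff)
      then have "c * int d0 = c0 * int d" by linarith
      then have "(c * r) * g = (c1 * int d) * g" using cr by (simp add: mult_ac)
      then have "c * r = c1 * int d" using g by simp
      then have "r dvd c1 * int d" by (metis dvd_triv_right)
      then have "r dvd int d" using cr(3) by (simp add: coprime_dvd_mult_right_iff coprime_commute)
      then have "int P dvd int d" using rP dvd_trans by blast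
      then show ?thesis by simp
    qed
    with P zP show ?thesis by (intro that[of P]) (auto simp: near_def)
  qed
qed

text \<open>For each pair of points the separating prime of \<open>\<bar>x - x'\<bar>\<close> is chosen, and \<open>mods x\<close> consists of the moduli
divisible by none of the primes belonging to \<open>x\<close>. The absolute value makes the choice symmetric in \<open>x\<close>
and \<open>x'\<close>. Each prime exceeds \<open>z\<close> and so costs at most the fraction \<open>1/z\<close> of the total mass, hence the
factor \<open>1 - card X / z\<close>. The remaining fractions are at distance at least \<open>\<delta>\<close> or
\<open>\<eta> = 1/(2 Q\<^sup>4)\<close>: two representations \<open>c/d\<close> with \<open>d \<le> Q\<^sup>2\<close> that are not equal differ by \<open>2 \<eta>\<close> or more.\<close>

lemma rough_moduli_large_sieve:
  fixes X :: "real set"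
  assumes \<delta>: "0 < \<delta>" and ws: "well_spaced \<delta> X"
    and z: "0 < z" and Q: "0 < Q"
    and S: "S \<subseteq> {m..<m + n}" "\<And>p. p \<in> S \<Longrightarrow> prime p \<and> Q < p"
  defines "R \<equiv> {p. prime p \<and> z < p \<and> p \<le> Q}"
  shows "(1 - real (card X) / real z) * totient_sum R Q * (\<Sum>x\<in>X. (norm (exp_sum S u x))\<^sup>2)
    \<le> (real n + 2 / \<delta> + 4 * real (Q ^ 4)) * (\<Sum>n\<in>S. (norm (u n))\<^sup>2)"
proof -
  define \<eta> where "\<eta> = 1 / (2 * real (Q ^ 4))"
  have \<eta>0: "\<eta> > 0" using Q by (simp add: \<eta>_def)
  have finX: "finite X" using well_spaced_finite[OF \<delta> ws] .
  define collision where "collision P \<theta> \<longleftrightarrow> prime P \<and> z < P \<and>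
    (\<forall>c d. 0 < d \<longrightarrow> d \<le> Q ^ 2 \<longrightarrow> (\<forall>p. prime p \<longrightarrow> p dvd d \<longrightarrow> z < p) \<longrightarrow> \<not> int d dvd c \<longrightarrow>
      \<bar>\<theta> + real_of_int c / real d\<bar> < \<eta> \<longrightarrow> P dvd d)" for P :: nat and \<theta>
  have "\<exists>P. collision P \<theta>" for \<theta>
  proof -
    have "2 * \<eta> \<le> 1 / real ((Q ^ 2) ^ 2)" by (simp add: \<eta>_def)
    from separating_prime[OF this, of z \<theta>] show ?thesis unfolding collision_def by metis
  qed
  then obtain P where P: "\<And>\<theta>. collision (P \<theta>) \<theta>" by metis
  define mods where "mods x = {q \<in> sqfree_over R Q. \<forall>x'\<in>X - {x}. \<not> P \<bar>x - x'\<bar> dvd q}" for x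
  define f where "f q = 1 / real (totient q)" for q
  define G where "G = totient_sum R Q"
  have G0: "G \<ge> 0" by (simp add: G_def totient_sum_nonneg)
  have mods: "q > 0" "q \<le> Q" "squarefree q" "\<And>p. prime p \<Longrightarrow> p dvd q \<Longrightarrow> z < p"
      "\<And>x'. x' \<in> X \<Longrightarrow> x' \<noteq> x \<Longrightarrow> \<not> P \<bar>x - x'\<bar> dvd q" if "q \<in> mods x" for q x
    using that by (auto simp: mods_def sqfree_over_def numbers_over_def R_def in_prime_factors_iff)
  have mass: "(1 - real (card X) / real z) * G \<le> (\<Sum>q\<in>mods x. f q)" for x
  proof -
    have "G - (\<Sum>q\<in>mods x. f q) = (\<Sum>q\<in>sqfree_over R Q - mods x. f q)"
      unfolding G_def totient_sum_def f_def by (rule sum_diff[symmetric]) (auto simp: mods_def)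
    also have "\<dots> \<le> (\<Sum>q\<in>sqfree_over R Q - mods x. \<Sum>x'\<in>X - {x}. if P \<bar>x - x'\<bar> dvd q then f q else 0)"
    proof (rule sum_mono)
      fix q assume "q \<in> sqfree_over R Q - mods x"
      then obtain x' where x': "x' \<in> X - {x}" "P \<bar>x - x'\<bar> dvd q" by (auto simp: mods_def)
      then have "f q = (if P \<bar>x - x'\<bar> dvd q then f q else 0)" by simp
      also have "\<dots> \<le> (\<Sum>x'\<in>X - {x}. if P \<bar>x - x'\<bar> dvd q then f q else 0)"
        using x' finX by (intro member_le_sum) (auto simp: f_def)
      finally show "f q \<le> (\<Sum>x'\<in>X - {x}. if P \<bar>x - x'\<bar> dvd q then f q else 0)" .
    qed
    also have "\<dots> \<le> (\<Sum>q\<in>sqfree_over R Q. \<Sum>x'\<in>X - {x}. if P \<bar>x - x'\<bar> dvd q then f q else 0)"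
      by (intro sum_mono2 sum_nonneg) (auto simp: f_def)
    also have "\<dots> = (\<Sum>x'\<in>X - {x}. \<Sum>q\<in>{q\<in>sqfree_over R Q. P \<bar>x - x'\<bar> dvd q}. f q)"
      by (subst sum.swap) (simp add: sum.inter_filter)
    also have "\<dots> \<le> (\<Sum>x'\<in>X - {x}. G / real z)"
    proof (rule sum_mono)
      fix x'
      have p: "prime (P \<bar>x - x'\<bar>)" "z < P \<bar>x - x'\<bar>" using P by (auto simp: collision_def)
      have "(\<Sum>q\<in>{q\<in>sqfree_over R Q. P \<bar>x - x'\<bar> dvd q}. f q) \<le> G / real (P \<bar>x - x'\<bar> - 1)"
        unfolding f_def G_def by (rule totient_sum_multiples_le[OF p(1)])
      also have "\<dots> \<le> G / real z"
        using p z G0 by (intro divide_left_mono of_nat_mono) auto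
      finally show "(\<Sum>q\<in>{q\<in>sqfree_over R Q. P \<bar>x - x'\<bar> dvd q}. f q) \<le> G / real z" .
    qed
    also have "\<dots> \<le> real (card X) * (G / real z)"
      using G0 finX by (simp only: sum_constant) (intro mult_right_mono of_nat_mono card_mono; auto)
    finally show ?thesis by (simp add: algebra_simps)
  qed
  define \<delta>' where "\<delta>' = min \<delta> \<eta>"
  have \<delta>': "\<delta>' > 0" using \<delta> \<eta>0 by (simp add: \<delta>'_def)
  have "(1 - real (card X) / real z) * G * (\<Sum>x\<in>X. (norm (exp_sum S u x))\<^sup>2)
    \<le> (\<Sum>x\<in>X. (\<Sum>q\<in>mods x. 1 / real (totient q)) * (norm (exp_sum S u x))\<^sup>2)"
    unfolding sum_distrib_left using mass by (intro sum_mono mult_right_mono) (auto simp: f_def)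
  also have "\<dots> \<le> (real n + 2 / \<delta>') * (\<Sum>n\<in>S. (norm (u n))\<^sup>2)"
  proof (rule sifted_large_sieve[OF finX _ \<delta>' _ _ _ S(1)])
    show "finite (mods x)" for x by (simp add: mods_def)
    fix x q assume q: "q \<in> mods x"
    show "squarefree q" using mods(3)[OF q] .
    show "coprime p q" if "p \<in> S" for p
      using S(2)[OF that] mods(1,2)[OF q] by (intro coprime_large_prime) auto
  next
    fix x q a x' q' a'
    assume x: "x \<in> X" "x' \<in> X" and q: "q \<in> mods x" "q' \<in> mods x'"
      and a: "a \<in> totatives q" "a' \<in> totatives q'" and ne: "(x, q, a) \<noteq> (x', q', a')"
    have q0: "q > 0" "q' > 0" "q \<le> Q" "q' \<le> Q" using mods(1,2) q by auto
    show "\<delta>' \<le> dist_Z ((x + real a / real q) - (x' + real a' / real q'))"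
    proof (cases "x = x'")
      case True
      have "\<eta> \<le> 1 / real (Q ^ 2)"
        using Q power_increasing[of 2 4 "real Q"] unfolding \<eta>_def
        by (intro frac_le) (auto intro: order.trans)
      also have "\<dots> \<le> dist_Z (real a / real q - real a' / real q')"
        using True ne by (intro totative_fractions_spaced a q0) auto
      finally show ?thesis using True by (simp add: \<delta>'_def)
    next
      case False
      obtain k where k: "dist_Z ((x + real a / real q) - (x' + real a' / real q'))
        = \<bar>(x + real a / real q) - (x' + real a' / real q') - real_of_int k\<bar>"
        by (rule dist_Z_attained)
      \<comment> \<open>Modulo 1 the two fractions differ by \<open>x - x' + c/(q q')\<close>.\<close>
      define c where "c = int a * int q' - int a' * int q - k * int q * int q'"
      have d: "dist_Z ((x + real a / real q) - (x' + real a' / real q'))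
        = \<bar>(x - x') + real_of_int c / real (q * q')\<bar>"
        unfolding k c_def fraction_diff_eq[OF q0(1,2), symmetric] by (simp add: algebra_simps)
      show ?thesis
      proof (cases "int (q * q') dvd c")
        case True
        then obtain j where "c = int (q * q') * j" by auto
        then have "real_of_int c / real (q * q') = real_of_int j" using q0 by simp
        then have "dist_Z ((x + real a / real q) - (x' + real a' / real q')) = \<bar>(x - x') - real_of_int (- j)\<bar>"
          using d by simp
        also have "\<dots> \<ge> dist_Z (x - x')" by (rule dist_Z_le)
        also have "dist_Z (x - x') \<ge> \<delta>" using ws x False by (auto simp: well_spaced_def)
        finally show ?thesis by (simp add: \<delta>'_def)
      next
        case ndvd: False
        have "\<not> \<bar>(x - x') + real_of_int c / real (q * q')\<bar> < \<eta>"
        proof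
          assume less: "\<bar>(x - x') + real_of_int c / real (q * q')\<bar> < \<eta>"
          \<comment> \<open>The separating prime was chosen for \<open>\<bar>x - x'\<bar>\<close>, so the sign of \<open>c\<close> may have to change.\<close>
          obtain c' where c': "\<bar>\<bar>x - x'\<bar> + real_of_int c' / real (q * q')\<bar> < \<eta>" "\<not> int (q * q') dvd c'"
          proof (cases "x - x' \<ge> 0")
            case True
            then show ?thesis using that[of c] less ndvd by simp
          next
            case False
            then have "\<bar>\<bar>x - x'\<bar> + real_of_int (- c) / real (q * q')\<bar> < \<eta>" using less by simp
            then show ?thesis using that[of "- c"] ndvd by simp
          qed
          have "q * q' \<le> Q ^ 2" using q0 by (simp add: power2_eq_square mult_le_mono)
          moreover have "z < p" if "prime p" "p dvd q * q'" for p
            using that mods(4) q by (auto simp: prime_dvd_mult_iff)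
          ultimately have "P \<bar>x - x'\<bar> dvd q * q'"
            using P[of "\<bar>x - x'\<bar>"] c' q0 unfolding collision_def by auto
          then have "P \<bar>x - x'\<bar> dvd q \<or> P \<bar>x' - x\<bar> dvd q'"
            using P[of "\<bar>x - x'\<bar>"] by (simp add: collision_def prime_dvd_mult_iff abs_minus_commute)
          then show False using mods(5)[OF q(1) x(2)] mods(5)[OF q(2) x(1)] False by auto
        qed
        then show ?thesis using d by (simp add: \<delta>'_def)
      qed
    qed
  qed
  also have "\<dots> \<le> (real n + 2 / \<delta> + 4 * real (Q ^ 4)) * (\<Sum>n\<in>S. (norm (u n))\<^sup>2)"
  proof (rule mult_right_mono)
    have "2 / \<delta>' \<le> 2 / \<delta> + 2 / \<eta>" using \<delta> \<eta>0 by (auto simp: \<delta>'_def min_def)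
    also have "2 / \<eta> = 4 * real (Q ^ 4)" by (simp add: \<eta>_def)
    finally show "real n + 2 / \<delta>' \<le> real n + 2 / \<delta> + 4 * real (Q ^ 4)" by simp
  qed (simp add: sum_nonneg)
  finally show ?thesis by (simp add: G_def)
qed

text \<open>If \<open>ln N \<le> 800 ln K\<close>, the large sieve inequality already suffices. Otherwise \<open>N\<close> exceeds a huge power of
\<open>K\<close>, and \<open>Q = \<lfloor>N\<^bsup>1/8\<^esup>\<rfloor>\<close> makes both \<open>Q\<^sup>4\<close> and the contribution of the primes up to \<open>Q\<close> negligible, the latter
by the trivial bound \<open>K Q W\<close>. The primes above \<open>Q\<close> are coprime to all moduli up to \<open>Q\<close>, and the preceding
lemma applies with \<open>z = K\<^sup>2\<close>; the gain is \<open>ln Q / (2 + 32 ln K)\<close>.\<close>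

lemma many_points_large_sieve:
  fixes X :: "real set" and u :: "nat \<Rightarrow> complex"
  assumes \<delta>: "0 < \<delta>" and ws: "well_spaced \<delta> X" and N: "N \<ge> 1000" and M: "M \<ge> 0"
    and K: "card X \<ge> 3500"
  defines "A \<equiv> primes_between (M + 1) (M + N)"
  shows "(\<Sum>x\<in>X. (norm (exp_sum A u x))\<^sup>2)
    \<le> 1600 * ln (real (card X)) * ((N + 1 / \<delta>) / ln N * (\<Sum>p\<in>A. (norm (u p))\<^sup>2))"
proof -
  define W where "W = (\<Sum>p\<in>A. (norm (u p))\<^sup>2)"
  define k where "k = ln (real (card X))"
  define L where "L = ln N"
  have W0: "W \<ge> 0" by (simp add: W_def sum_nonneg)
  have finX: "finite X" using well_spaced_finite[OF \<delta> ws] .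
  have L6: "L \<ge> 68 / 10" using ln_1000_ge N ln_mono[of 1000 N] unfolding L_def by linarith
  have k6: "k \<ge> 68 / 10"
    using ln_1000_ge K ln_mono[of 1000 "real (card X)"] unfolding k_def by linarith
  obtain m n where mn: "A \<subseteq> {m..<m + n}" "real n \<le> N"
    using primes_between_interval[of M N] N M unfolding A_def by auto
  have finA: "finite A" using mn finite_subset by blast
  have N\<delta>: "N + 1 / \<delta> > 0" using N \<delta> by (simp add: add_pos_pos)
  have NW: "(N + 1 / \<delta>) * W \<ge> 0" using N\<delta> W0 by simp
  have goal: "(\<Sum>x\<in>X. (norm (exp_sum A u x))\<^sup>2) \<le> 1600 * k / L * ((N + 1 / \<delta>) * W)"
  proof (cases "L \<le> 800 * k")
    case True
    have "(\<Sum>x\<in>X. (norm (exp_sum A u x))\<^sup>2) \<le> (real n + 2 / \<delta>) * W"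
      unfolding W_def using ws by (intro large_sieve[OF finX \<delta> _ mn(1)]) (auto simp: well_spaced_def)
    also have "\<dots> \<le> 2 * ((N + 1 / \<delta>) * W)"
    proof -
      have "real n + 2 / \<delta> \<le> 2 * (N + 1 / \<delta>)" using mn N by simp
      from mult_right_mono[OF this W0] show ?thesis by (simp only: mult.assoc)
    qed
    also have "\<dots> \<le> 1600 * k / L * ((N + 1 / \<delta>) * W)"
      using True L6 by (intro mult_right_mono NW) (simp add: pos_le_divide_eq)
    finally show ?thesis .
  next
    case False
    define Q where "Q = nat \<lfloor>N powr (1 / 8)\<rfloor>"
    define K where "K = card X"
    have K0: "K \<ge> 3500" using assms(5) by (simp add: K_def)
    have KN: "real K \<le> N powr (1 / 8)"
    proof -
      have "k \<le> 1 / 8 * L" using False k6 by linarith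
      then have "exp k \<le> exp (1 / 8 * L)" by simp
      then show ?thesis using K0 N by (simp add: k_def K_def[symmetric] L_def powr_def)
    qed
    have QN: "real Q \<le> N powr (1 / 8)" "N powr (1 / 8) < real Q + 1" "Q > 0"
      using KN K0 unfolding Q_def by linarith+
    have N4: "real Q ^ 4 \<le> N powr (1 / 2)"
    proof -
      have "real Q ^ 4 \<le> (N powr (1 / 8)) ^ 4" using QN by (intro power_mono) auto
      also have "\<dots> = N powr (1 / 2)" using N by (simp add: powr_power)
      finally show ?thesis .
    qed
    have Nh: "4 * N powr (1 / 2) \<le> N"
    proof -
      have "4 \<le> sqrt N" using N by (intro real_le_rsqrt) auto
      then have "4 * sqrt N \<le> sqrt N * sqrt N" using N by (intro mult_right_mono) auto
      then show ?thesis using N by (simp add: powr_half_sqrt)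
    qed
    define S where "S = {p \<in> A. Q < p}"
    define S' where "S' = {p \<in> A. p \<le> Q}"
    have split: "exp_sum A u x = exp_sum S u x + exp_sum S' u x" for x
    proof -
      have "A = S \<union> S'" "S \<inter> S' = {}" by (auto simp: S_def S'_def)
      then show ?thesis unfolding exp_sum_def using finA by (simp add: sum.union_disjoint)
    qed
    have WS: "(\<Sum>p\<in>S. (norm (u p))\<^sup>2) \<le> W" "(\<Sum>p\<in>S'. (norm (u p))\<^sup>2) \<le> W"
      unfolding W_def using finA by (auto intro!: sum_mono2 simp: S_def S'_def)
    have small: "(\<Sum>x\<in>X. (norm (exp_sum S' u x))\<^sup>2) \<le> 4 / 3 * (N / L * W)"
    proof -
      have "(norm (exp_sum S' u x))\<^sup>2 \<le> real Q * W" for x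
      proof -
        have "norm (exp_sum S' u x) \<le> (\<Sum>p\<in>S'. 1 * norm (u p))"
          unfolding exp_sum_def by (rule order.trans[OF norm_sum]) (simp add: norm_mult)
        then have "(norm (exp_sum S' u x))\<^sup>2 \<le> (\<Sum>p\<in>S'. 1 * norm (u p))\<^sup>2"
          by (intro power_mono) auto
        also have "\<dots> \<le> (\<Sum>p\<in>S'. 1\<^sup>2) * (\<Sum>p\<in>S'. (norm (u p))\<^sup>2)"
          by (rule Cauchy_Schwarz_ineq_sum)
        also have "\<dots> \<le> real Q * W"
        proof (rule mult_mono)
          have "S' \<subseteq> {1..Q}" by (auto simp: S'_def A_def primes_between_def dest: prime_ge_1_nat)
          then have "card S' \<le> Q" using card_mono[of "{1..Q}" S'] by simp
          then show "(\<Sum>p\<in>S'. 1\<^sup>2) \<le> real Q" by simp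
        qed (use WS in \<open>auto intro: sum_nonneg\<close>)
        finally show ?thesis .
      qed
      then have "(\<Sum>x\<in>X. (norm (exp_sum S' u x))\<^sup>2) \<le> (\<Sum>x\<in>X. real Q * W)"
        by (intro sum_mono)
      also have "\<dots> = (real K * real Q) * W" by (simp add: K_def)
      also have "\<dots> \<le> (4 / 3 * N / L) * W"
      proof (rule mult_right_mono[OF _ W0])
        have "real K * real Q \<le> N powr (1 / 8) * N powr (1 / 8)"
          using KN QN by (intro mult_mono) auto
        also have "\<dots> = N powr (1 / 4)" by (simp flip: powr_add)
        finally have KQ: "real K * real Q \<le> N powr (1 / 4)" .
        have "L \<le> N powr (3 / 4) / (3 / 4)"
          unfolding L_def using N by (intro ln_powr_bound) auto
        then have "N powr (1 / 4) * L \<le> N powr (1 / 4) * (N powr (3 / 4) / (3 / 4))"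
          by (intro mult_left_mono) auto
        also have "\<dots> = (N powr (1 / 4) * N powr (3 / 4)) * (4 / 3)" by simp
        also have "N powr (1 / 4) * N powr (3 / 4) = N" using N by (simp flip: powr_add)
        finally have "N powr (1 / 4) \<le> 4 / 3 * N / L" using L6 by (simp add: pos_le_divide_eq)
        with KQ show "real K * real Q \<le> 4 / 3 * N / L" by linarith
      qed
      finally show ?thesis by simp
    qed
    have large: "(\<Sum>x\<in>X. (norm (exp_sum S u x))\<^sup>2) \<le> 530 * k / L * ((N + 1 / \<delta>) * W)"
    proof -
      define z where "z = K ^ 2"
      define B where "B = (\<Sum>x\<in>X. (norm (exp_sum S u x))\<^sup>2)"
      define G where "G = totient_sum {p. prime p \<and> z < p \<and> p \<le> Q} Q"
      have B0: "B \<ge> 0" by (simp add: B_def sum_nonneg)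
      have z: "0 < z" "2 \<le> z" using K0 power_mono[of 2 K 2] by (auto simp: z_def)
      have "(1 - real K / real z) * G * B
        \<le> (real n + 2 / \<delta> + 4 * real (Q ^ 4)) * (\<Sum>p\<in>S. (norm (u p))\<^sup>2)"
        unfolding G_def B_def K_def
      proof (rule rough_moduli_large_sieve[OF \<delta> ws z(1) QN(3)])
        show "S \<subseteq> {m..<m + n}" using mn by (auto simp: S_def)
        show "prime p \<and> Q < p" if "p \<in> S" for p using that by (simp add: S_def A_def primes_between_def)
      qed
      also have "\<dots> \<le> (2 * (N + 1 / \<delta>)) * W"
        using mn N4 Nh WS N\<delta> by (intro mult_mono) (auto intro: sum_nonneg)
      also have "1 - real K / real z = 1 - 1 / real K" using K0 by (simp add: z_def power2_eq_square)
      finally have *: "(1 - 1 / real K) * G * B \<le> 2 * ((N + 1 / \<delta>) * W)" by (simp only: mult.assoc)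
      have "1 / 8 * L \<le> ln (real Q + 1)"
      proof -
        have "1 / 8 * L = ln (N powr (1 / 8))" using N by (simp add: ln_powr L_def)
        also have "\<dots> \<le> ln (real Q + 1)" using QN N by (intro ln_mono) auto
        finally show ?thesis .
      qed
      also have "\<dots> \<le> (2 + 16 * ln (real z)) * G"
        unfolding G_def by (rule rough_totient_sum_ge[OF z(2)])
      also have "ln (real z) = 2 * k" using K0 by (simp add: z_def k_def K_def ln_realpow)
      finally have G1: "1 / 8 * L \<le> (2 + 16 * (2 * k)) * G" .
      have G0: "G \<ge> 0" by (simp add: G_def totient_sum_nonneg)
      have "(2 + 16 * (2 * k)) * G \<le> (33 * k) * G" using k6 G0 by (intro mult_right_mono) auto
      with G1 have G2: "L \<le> 264 * k * G" by simp
      have "3499 / 3500 \<le> 1 - 1 / real K" using K0 by (simp add: field_simps)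
      then have "3499 / 3500 * (G * B) \<le> (1 - 1 / real K) * (G * B)"
        using G0 B0 by (intro mult_right_mono) auto
      then have GB: "G * B \<le> 3500 / 3499 * 2 * ((N + 1 / \<delta>) * W)"
        using * unfolding mult.assoc[of _ G B] by linarith
      have "L * B \<le> (264 * k * G) * B" using G2 B0 by (rule mult_right_mono)
      also have "\<dots> = 264 * k * (G * B)" by simp
      also have "\<dots> \<le> 264 * k * (3500 / 3499 * 2 * ((N + 1 / \<delta>) * W))"
        using GB k6 by (intro mult_left_mono) auto
      also have "\<dots> = (264 * (3500 / 3499) * 2) * (k * ((N + 1 / \<delta>) * W))" by simp
      also have "\<dots> \<le> 530 * (k * ((N + 1 / \<delta>) * W))"
        using k6 by (intro mult_right_mono mult_nonneg_nonneg[OF _ NW]) auto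
      finally have "B \<le> 530 * (k * ((N + 1 / \<delta>) * W)) / L" using L6 by (simp add: pos_le_divide_eq mult.commute)
      then show ?thesis by (simp add: B_def)
    qed
    have "(\<Sum>x\<in>X. (norm (exp_sum A u x))\<^sup>2)
      \<le> (\<Sum>x\<in>X. 2 * (norm (exp_sum S u x))\<^sup>2 + 2 * (norm (exp_sum S' u x))\<^sup>2)"
    proof (rule sum_mono)
      fix x
      have "(norm (exp_sum A u x))\<^sup>2 \<le> (norm (exp_sum S u x) + norm (exp_sum S' u x))\<^sup>2"
        unfolding split by (intro power_mono norm_triangle_ineq) auto
      also have "\<dots> \<le> 2 * (norm (exp_sum S u x))\<^sup>2 + 2 * (norm (exp_sum S' u x))\<^sup>2"
        using sum_squares_bound[of "norm (exp_sum S u x)" "norm (exp_sum S' u x)"]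
        by (simp add: power2_sum)
      finally show "(norm (exp_sum A u x))\<^sup>2 \<le> 2 * (norm (exp_sum S u x))\<^sup>2 + 2 * (norm (exp_sum S' u x))\<^sup>2" .
    qed
    also have "\<dots> = 2 * (\<Sum>x\<in>X. (norm (exp_sum S u x))\<^sup>2) + 2 * (\<Sum>x\<in>X. (norm (exp_sum S' u x))\<^sup>2)"
      by (simp add: sum.distrib sum_distrib_left)
    also have "\<dots> \<le> 2 * (530 * k / L * ((N + 1 / \<delta>) * W)) + 2 * (4 / 3 * (N / L * W))"
      using large small by linarith
    also have "\<dots> \<le> 1060 * k / L * ((N + 1 / \<delta>) * W) + 3 / L * ((N + 1 / \<delta>) * W)"
    proof -
      have "N * W \<le> (N + 1 / \<delta>) * W" using \<delta> W0 by (intro mult_right_mono) auto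
      then have "8 / 3 * (N * W) \<le> 3 * ((N + 1 / \<delta>) * W)" using NW by linarith
      then have "8 / 3 * (N * W) / L \<le> 3 * ((N + 1 / \<delta>) * W) / L"
        using L6 by (intro divide_right_mono) auto
      then show ?thesis by simp
    qed
    also have "\<dots> = (1060 * k + 3) / L * ((N + 1 / \<delta>) * W)"
      by (simp add: add_divide_distrib distrib_right)
    also have "\<dots> \<le> 1600 * k / L * ((N + 1 / \<delta>) * W)"
      using k6 L6 by (intro mult_right_mono divide_right_mono NW) auto
    finally show ?thesis .
  qed
  then show ?thesis by (simp add: k_def L_def W_def)
qed

section \<open>Power sums from partial sums\<close>

lemma powr_mult_le_Young:
  fixes w z s :: real
  assumes "0 \<le> w" "0 \<le> z" "1 < s"
  shows "w * z powr (s - 1) \<le> w powr s / s + (1 - 1 / s) * z powr s"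
proof -
  have "w * z powr (s - 1) \<le> w powr s / s + (z powr (s - 1)) powr (s / (s - 1)) / (s / (s - 1))"
    by (rule Youngs_inequality) (use assms in \<open>auto simp: field_simps\<close>)
  also have "(z powr (s - 1)) powr (s / (s - 1)) = z powr s"
    using assms by (simp add: powr_powr)
  also have "z powr s / (s / (s - 1)) = (1 - 1 / s) * z powr s"
    using assms by (simp add: field_simps)
  finally show ?thesis .
qed

text \<open>Abel summation: the sum of \<open>(w j - z j) * g j\<close> is a combination of the nonnegative partial sums of
\<open>w - z\<close> with the nonnegative coefficients \<open>g j - g (j + 1)\<close>.\<close>

lemma sum_by_parts_mono:
  fixes z w g :: "nat \<Rightarrow> real"
  assumes dec: "\<And>j. Suc j < n \<Longrightarrow> g (Suc j) \<le> g j" and g0: "\<And>j. j < n \<Longrightarrow> 0 \<le> g j"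
    and le: "\<And>k. k \<le> n \<Longrightarrow> sum z {..<k} \<le> sum w {..<k}"
  shows "(\<Sum>j<n. z j * g j) \<le> (\<Sum>j<n. w j * g j)"
proof -
  define d where "d j = w j - z j" for j
  have d: "0 \<le> sum d {..<k}" if "k \<le> n" for k
    using le[OF that] by (simp add: d_def sum_subtractf)
  have "m \<le> n \<Longrightarrow> m > 0 \<Longrightarrow> g (m - 1) * sum d {..<m} \<le> (\<Sum>j<m. d j * g j)" for m
  proof (induction m)
    case (Suc m)
    show ?case
    proof (cases "m = 0")
      case False
      have "g m * sum d {..<m} \<le> g (m - 1) * sum d {..<m}"
        using dec[of "m - 1"] Suc.prems False by (intro mult_right_mono d) auto
      also have "\<dots> \<le> (\<Sum>j<m. d j * g j)" using Suc False by simp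
      finally show ?thesis by (simp add: algebra_simps)
    qed simp
  qed simp
  from this[of n] have "0 \<le> (\<Sum>j<n. d j * g j)"
    using g0[of "n - 1"] d[of n] by (cases "n = 0") (auto intro: order.trans[rotated])
  then show ?thesis by (simp add: d_def left_diff_distrib sum_subtractf)
qed

text \<open>A form of weak majorization. Summation by parts with \<open>g = z\<^bsup>s - 1\<^esup>\<close> gives
\<open>\<Sum>z\<^sup>s \<le> \<Sum>w z\<^bsup>s - 1\<^esup>\<close>, and Young's inequality allows the sum of \<open>z\<^sup>s\<close> to be absorbed.\<close>

lemma powr_sum_le_of_partial_sums_le:
  fixes z w :: "nat \<Rightarrow> real"
  assumes s: "1 < s"
    and dec: "\<And>j. Suc j < n \<Longrightarrow> z (Suc j) \<le> z j" and z0: "\<And>j. j < n \<Longrightarrow> 0 \<le> z j"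
    and w0: "\<And>j. j < n \<Longrightarrow> 0 \<le> w j"
    and le: "\<And>k. k \<le> n \<Longrightarrow> sum z {..<k} \<le> sum w {..<k}"
  shows "(\<Sum>j<n. z j powr s) \<le> (\<Sum>j<n. w j powr s)"
proof -
  have "(\<Sum>j<n. z j powr s) = (\<Sum>j<n. z j * z j powr (s - 1))"
  proof (intro sum.cong refl)
    fix j assume "j \<in> {..<n}"
    then show "z j powr s = z j * z j powr (s - 1)"
      using z0[of j] by (cases "z j = 0") (auto simp: powr_mult_base)
  qed
  also have "\<dots> \<le> (\<Sum>j<n. w j * z j powr (s - 1))"
    by (rule sum_by_parts_mono) (use s dec z0 le in \<open>auto intro!: powr_mono2\<close>)
  also have "\<dots> \<le> (\<Sum>j<n. w j powr s / s + (1 - 1 / s) * z j powr s)"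
    using s z0 w0 by (intro sum_mono powr_mult_le_Young) auto
  also have "\<dots> = (\<Sum>j<n. w j powr s) / s + (1 - 1 / s) * (\<Sum>j<n. z j powr s)"
    by (simp add: sum.distrib sum_divide_distrib sum_distrib_left)
  finally have "(\<Sum>j<n. z j powr s) / s \<le> (\<Sum>j<n. w j powr s) / s"
    by (simp add: algebra_simps)
  then show ?thesis using s by (simp add: divide_le_cancel)
qed

text \<open>The telescoping form of the comparison of \<open>\<Sum>(m/j)\<^bsup>1 + c\<^esup>\<close> with the integral of \<open>(m/x)\<^bsup>1 + c\<^esup>\<close>.\<close>

lemma powr_tail_step:
  fixes m c :: real and j :: nat
  assumes "0 < m" "0 < c" "0 < j"
  shows "(m / real (Suc j)) powr (1 + c) \<le> m / c * ((m / real j) powr c - (m / real (Suc j)) powr c)"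
proof -
  define b where "b = real (Suc j)"
  have b: "b > 1" "real j = b - 1" using assms by (auto simp: b_def)
  have r: "b / (b - 1) > 0" using b by simp
  have "ln ((b - 1) / b) \<le> (b - 1) / b - 1" using b by (intro ln_le_minus_one) auto
  moreover have "(b - 1) / b - 1 = - (1 / b)" using b by (simp add: field_simps)
  moreover have "ln (b / (b - 1)) = - ln ((b - 1) / b)" using b by (simp add: ln_div)
  ultimately have "1 / b \<le> ln (b / (b - 1))" by linarith
  then have "c * (1 / b) \<le> c * ln (b / (b - 1))" using assms by (intro mult_left_mono) auto
  then have "c / b \<le> c * ln (b / (b - 1))" by simp
  moreover have "1 + c * ln (b / (b - 1)) \<le> exp (c * ln (b / (b - 1)))" by (rule exp_ge_add_one_self)
  ultimately have "1 + c / b \<le> exp (c * ln (b / (b - 1)))" by linarith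
  also have "\<dots> = (b / (b - 1)) powr c" using r b by (simp add: powr_def)
  finally have "(1 + c / b) * (m / b) powr c \<le> (b / (b - 1)) powr c * (m / b) powr c"
    by (rule mult_right_mono) simp
  also have "\<dots> = (b / (b - 1) * (m / b)) powr c"
    using b assms by (subst powr_mult) auto
  also have "b / (b - 1) * (m / b) = m / (b - 1)" using b by simp
  finally have "c / b * (m / b) powr c \<le> (m / (b - 1)) powr c - (m / b) powr c" by (simp add: distrib_right)
  then have "m / c * (c / b * (m / b) powr c) \<le> m / c * ((m / (b - 1)) powr c - (m / b) powr c)"
    using assms by (intro mult_left_mono) auto
  moreover have "(m / b) powr (1 + c) = m / c * (c / b * (m / b) powr c)"
  proof -
    have "(m / b) powr (1 + c) = (m / b) powr 1 * (m / b) powr c" by (rule powr_add)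
    also have "(m / b) powr 1 = m / b" using assms b by simp
    finally have "(m / b) powr (1 + c) = m / b * (m / b) powr c" .
    then show ?thesis using assms by simp
  qed
  ultimately have "(m / b) powr (1 + c) \<le> m / c * ((m / (b - 1)) powr c - (m / b) powr c)"
    by (simp only:)
  then show ?thesis unfolding b(2) b_def[symmetric] .
qed

text \<open>The first 3500 terms carry the trivial bound 4. Their total 14000 has to dominate
\<open>1600 ln 3500\<close>, about 13057; from there on terms \<open>3500/k\<close> grow faster in sum than \<open>1600 ln k\<close>. The index \<open>j\<close>
counts from 0.\<close>

definition profile :: "nat \<Rightarrow> real" where
  "profile j = (if j < 3500 then 4 else 3500 / real (Suc j))"

lemma sum_profile_powr_le:
  assumes h: "0 < h"
  shows "(\<Sum>j<n. profile j powr (1 + h / 2)) \<le> 14000 * (2 powr h + 1 / h)"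
proof -
  define c where "c = h / 2"
  have c: "c > 0" using h by (simp add: c_def)
  have p4: "4 powr (1 + c) = 4 * 2 powr h"
  proof -
    have "4 powr c = (2 powr 2) powr c" by simp
    also have "\<dots> = 2 powr h" unfolding powr_powr by (simp add: c_def)
    finally show ?thesis by (simp add: powr_add)
  qed
  have head: "(\<Sum>j<n. profile j powr (1 + c)) \<le> 14000 * 2 powr h" if "n \<le> 3500" for n
  proof -
    have "(\<Sum>j<n. profile j powr (1 + c)) = (\<Sum>j<n. 4 * 2 powr h)"
      using that by (intro sum.cong) (auto simp: profile_def p4)
    also have "\<dots> \<le> 14000 * 2 powr h" using that by simp
    finally show ?thesis .
  qed
  have tail: "(\<Sum>j<3500 + i. profile j powr (1 + c))
      \<le> 14000 * 2 powr h + 3500 / c * (1 - (3500 / real (3500 + i)) powr c)" for i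
  proof (induction i)
    case 0
    then show ?case using head[of 3500] by simp
  next
    case (Suc i)
    have "profile (3500 + i) powr (1 + c)
      \<le> 3500 / c * ((3500 / real (3500 + i)) powr c - (3500 / real (Suc (3500 + i))) powr c)"
      using powr_tail_step[of 3500 c "3500 + i"] c by (simp add: profile_def)
    with Suc show ?case
      by (simp only: add_Suc_right sum.lessThan_Suc right_diff_distrib)
  qed
  have "(\<Sum>j<n. profile j powr (1 + c)) \<le> 14000 * 2 powr h + 3500 / c"
  proof (cases "n \<le> 3500")
    case True
    then show ?thesis using head[OF True] c by (smt (verit) divide_nonneg_pos)
  next
    case False
    then obtain i where n: "n = 3500 + i" by (metis le_add_diff_inverse nat_le_linear)
    have "3500 / c * (1 - (3500 / real (3500 + i)) powr c) \<le> 3500 / c * 1"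
      using c by (intro mult_left_mono) auto
    then show ?thesis using tail[of i] n by simp
  qed
  also have "3500 / c = 7000 / h" by (simp add: c_def)
  also have "14000 * 2 powr h + 7000 / h \<le> 14000 * (2 powr h + 1 / h)"
    using h by (simp add: distrib_left divide_right_mono)
  finally show ?thesis by (simp add: c_def)
qed

lemma log_le_sum_profile:
  "3500 \<le> k \<Longrightarrow> 1600 * ln (real k) \<le> sum profile {..<k}"
proof (induction k rule: dec_induct)
  case base
  \<comment> \<open>\<open>2\<^bsup>12\<^esup> = 4096\<close>\<close>
  have "ln (3500::real) \<le> ln (2 ^ 12)" by (subst ln_le_cancel_iff) auto
  also have "\<dots> = 12 * ln 2" by (subst ln_realpow) auto
  finally have "ln (3500::real) \<le> 12 * (25 / 36)" using ln2_le_25_over_36 by linarith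
  moreover have "sum profile {..<3500} = (\<Sum>j<(3500::nat). 4)"
    by (intro sum.cong) (auto simp: profile_def)
  ultimately show ?case by simp
next
  case (step k)
  have k: "real k \<ge> 3500" using step by simp
  have "ln (real (Suc k)) - ln (real k) \<le> 1 / real k"
    using ln_diff_le[of "real (Suc k)" "real k"] k by simp
  then have "1600 * (ln (real (Suc k)) - ln (real k)) \<le> 1600 / real k" by simp
  also have "\<dots> \<le> 3500 / real (Suc k)" using k by (simp add: field_simps)
  also have "\<dots> = profile k" using step by (simp add: profile_def)
  finally show ?case using step by simp
qed

lemma decreasing_enumeration:
  fixes f :: "'a \<Rightarrow> real"
  assumes "finite X"
  obtains xs where "set xs = X" "distinct xs" "length xs = card X"
    "\<And>j. Suc j < length xs \<Longrightarrow> f (xs ! Suc j) \<le> f (xs ! j)"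
proof -
  obtain ys where ys: "set ys = X" "distinct ys" using finite_distinct_list[OF assms] by blast
  define xs where "xs = sort_key (\<lambda>x. - f x) ys"
  have xs: "set xs = X" "distinct xs" using ys by (simp_all add: xs_def)
  have "sorted (map (\<lambda>x. - f x) xs)" by (simp add: xs_def)
  then have "f (xs ! Suc j) \<le> f (xs ! j)" if "Suc j < length xs" for j
    using sorted_nth_mono[of "map (\<lambda>x. - f x) xs" j "Suc j"] that by simp
  with xs show ?thesis using that[of xs] distinct_card[of xs] by auto
qed

lemma powr_sum_le_profile:
  fixes f :: "'a \<Rightarrow> real"
  assumes fin: "finite X" and s: "1 < s" and f: "\<And>x. x \<in> X \<Longrightarrow> 0 \<le> f x" "\<And>x. x \<in> X \<Longrightarrow> f x \<le> 4"
    and log: "\<And>Y. Y \<subseteq> X \<Longrightarrow> 3500 \<le> card Y \<Longrightarrow> (\<Sum>x\<in>Y. f x) \<le> 1600 * ln (real (card Y))"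
  shows "(\<Sum>x\<in>X. f x powr s) \<le> (\<Sum>j<card X. profile j powr s)"
proof -
  obtain xs where xs: "set xs = X" "distinct xs" "length xs = card X"
    and dec: "\<And>j. Suc j < length xs \<Longrightarrow> f (xs ! Suc j) \<le> f (xs ! j)"
    using decreasing_enumeration[OF fin, of f] by blast
  have bij: "bij_betw ((!) xs) {..<k} (set (take k xs))" if "k \<le> length xs" for k
    using bij_betw_nth[of "take k xs" "{..<k}"] that xs
    by (auto simp: bij_betw_def inj_on_def nth_eq_iff_index_eq nth_image)
  have inX: "xs ! j \<in> X" if "j < card X" for j using that xs by auto
  have "(\<Sum>x\<in>X. f x powr s) = (\<Sum>j<card X. f (xs ! j) powr s)"
    using sum.reindex_bij_betw[OF bij[of "card X"], of "\<lambda>x. f x powr s"] xs by simp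
  also have "\<dots> \<le> (\<Sum>j<card X. profile j powr s)"
  proof (rule powr_sum_le_of_partial_sums_le[OF s])
    fix k assume k: "k \<le> card X"
    show "(\<Sum>j<k. f (xs ! j)) \<le> sum profile {..<k}"
    proof (cases "3500 \<le> k")
      case True
      have "(\<Sum>j<k. f (xs ! j)) = (\<Sum>x\<in>set (take k xs). f x)"
        using sum.reindex_bij_betw[OF bij[of k], of f] k xs by simp
      also have "\<dots> \<le> 1600 * ln (real (card (set (take k xs))))"
        using xs k True by (intro log) (auto simp: distinct_card dest: in_set_takeD)
      also have "card (set (take k xs)) = k" using xs k by (simp add: distinct_card)
      also have "1600 * ln (real k) \<le> sum profile {..<k}" using True by (rule log_le_sum_profile)
      finally show ?thesis .
    next
      case False
      then show ?thesis using k f inX by (intro sum_mono) (auto simp: profile_def)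
    qed
  qed (use dec xs f inX in \<open>auto simp: profile_def\<close>)
  finally show ?thesis .
qed

theorem theorem10p2:
  fixes \<delta> N M h :: real and X :: "real set" and u :: "nat \<Rightarrow> complex"
  assumes "\<delta> > 0" and "well_spaced \<delta> X"
    and "N \<ge> 1000" and "M \<ge> 0" and "h > 0"
  shows "(\<Sum>x\<in>X. norm (\<Sum>p\<in>primes_between (M + 1) (M + N). u p * e_unit (x * real p)) powr (2 + h))
    \<le> 14000 * (2 powr h + 1 / h) *
      ((N + 1 / \<delta>) / ln N * (\<Sum>p\<in>primes_between (M + 1) (M + N). (norm (u p))\<^sup>2)) powr (1 + h / 2)"
proof -
  define A where "A = primes_between (M + 1) (M + N)"
  define W where "W = (\<Sum>p\<in>A. (norm (u p))\<^sup>2)"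
  define C where "C = (N + 1 / \<delta>) / ln N * W"
  define s where "s = 1 + h / 2"
  define t where "t x = norm (exp_sum A u x)" for x
  have finX: "finite X" using well_spaced_finite[OF assms(1,2)] .
  have finA: "finite A" unfolding A_def using assms by (intro finite_primes_between) auto
  have lnN: "ln N > 0" using assms by simp
  have W0: "W \<ge> 0" by (simp add: W_def sum_nonneg)
  have C0: "C \<ge> 0" unfolding C_def using assms lnN W0 by (intro mult_nonneg_nonneg divide_nonneg_pos) auto
  have t_powr: "t x powr (2 + h) = ((t x)\<^sup>2) powr s" for x
  proof -
    have "((t x)\<^sup>2) powr s = (t x powr 2) powr s" by (simp add: t_def powr_numeral)
    then show ?thesis by (simp add: powr_powr s_def distrib_left)
  qed
  have t_le: "(t x)\<^sup>2 \<le> 4 * C" for x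
  proof -
    have "t x \<le> (\<Sum>p\<in>A. 1 * norm (u p))"
      unfolding t_def exp_sum_def by (rule order.trans[OF norm_sum]) (simp add: norm_mult)
    then have "(t x)\<^sup>2 \<le> (\<Sum>p\<in>A. 1 * norm (u p))\<^sup>2"
      by (intro power_mono) (auto simp: t_def)
    also have "\<dots> \<le> (\<Sum>p\<in>A. 1\<^sup>2) * W"
      unfolding W_def by (rule Cauchy_Schwarz_ineq_sum)
    also have "\<dots> = real (card A) * W" by simp
    also have "\<dots> \<le> (4 * N / ln N) * W"
      using brun_titchmarsh[OF assms(3,4)] W0 by (intro mult_right_mono) (auto simp: A_def)
    also have "\<dots> \<le> (4 * (N + 1 / \<delta>) / ln N) * W"
      using assms lnN W0 by (intro mult_right_mono divide_right_mono) auto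
    also have "\<dots> = 4 * C" unfolding C_def by (simp only: mult.assoc times_divide_eq_left times_divide_eq_right)
    finally show ?thesis .
  qed
  have "(\<Sum>x\<in>X. t x powr (2 + h)) \<le> 14000 * (2 powr h + 1 / h) * C powr s"
  proof (cases "C = 0")
    case True
    then have "t x = 0" for x using t_le[of x] by simp
    then show ?thesis using True by simp
  next
    case False
    with C0 have C: "C > 0" by simp
    have "(\<Sum>x\<in>X. t x powr (2 + h)) = (\<Sum>x\<in>X. ((t x)\<^sup>2 / C) powr s) * C powr s"
      unfolding sum_distrib_right t_powr using C by (intro sum.cong refl) (simp flip: powr_mult)
    also have "(\<Sum>x\<in>X. ((t x)\<^sup>2 / C) powr s) \<le> (\<Sum>j<card X. profile j powr s)"
    proof (rule powr_sum_le_profile[OF finX])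
      show "1 < s" using assms by (simp add: s_def)
      show "0 \<le> (t x)\<^sup>2 / C" "(t x)\<^sup>2 / C \<le> 4" for x
        using t_le[of x] C by (auto simp: divide_le_eq)
      fix Y assume Y: "Y \<subseteq> X" "3500 \<le> card Y"
      then have "well_spaced \<delta> Y" using assms(2) by (auto simp: well_spaced_def)
      from many_points_large_sieve[OF assms(1) this assms(3,4) Y(2), of u]
      have "(\<Sum>x\<in>Y. (t x)\<^sup>2) \<le> 1600 * ln (real (card Y)) * C"
        by (simp add: t_def C_def W_def A_def)
      then show "(\<Sum>x\<in>Y. (t x)\<^sup>2 / C) \<le> 1600 * ln (real (card Y))"
        using C by (simp add: pos_divide_le_eq flip: sum_divide_distrib)
    qed
    also have "\<dots> \<le> 14000 * (2 powr h + 1 / h)"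
      unfolding s_def by (rule sum_profile_powr_le[OF assms(5)])
    finally show ?thesis by (simp add: mult_right_mono)
  qed
  then show ?thesis by (simp add: t_def exp_sum_def C_def W_def A_def s_def)
qed

end
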